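(* Let $0\le T_0<T_1\le+\infty$ and let $\Gamma$ be a network as described in the context. Let $\{H_\gamma\}$ and, for each $n\in\mathbb{N}$, $\{H^n_\gamma\}$ be Hamiltonians on $\Gamma$ as in the context; let $c^n_x$, $x\in\mathbf{V}$, be real numbers with $c^n_x\le\min_{\gamma\in\Gamma_x}c^n_\gamma$, where $c^n_\gamma=-\max_{s}\min_p H^n_\gamma(s,p)$; and let $g_n:\Gamma\to\mathbb{R}$ be continuous. Assume that $H^n_\gamma(s,p)\to H_\gamma(s,p)$ uniformly in $[0,1]\times\mathbb{R}$ for every arc $\gamma$, that $g_n$ converges uniformly on $\Gamma$ to a function $g$, and that $c^n_x\to c_x$ for every $x\in\mathbf{V}$. Let $u_n:\Gamma\times[T_0,T_1)\to\mathbb{R}$ be the continuous solution of (HJ$\Gamma$) in $(T_0,T_1)$ with Hamiltonians $H^n_\gamma$ and flux limiter $c^n_x$ in place of $H_\gamma$, $c_x$, and with initial datum $u_n(\cdot,T_0)=g_n$. Then $u_n$ converges locally uniformly in $\Gamma\times[T_0,T_1)$ to the continuous solution $u$ of (HJ$\Gamma$) in $(T_0,T_1)$ with Hamiltonians $H_\gamma$, flux limiter $c_x$ and initial datum $u(\cdot,T_0)=g$.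
   Context: Network. $\Gamma=\bigcup_{\gamma\in\mathcal{E}}\gamma([0,1])\subset\mathbb{R}^N$, where $\mathcal{E}$ is a finite collection of arcs, i.e. simple $C^1$ curves $\gamma:[0,1]\to\mathbb{R}^N$ with nonvanishing derivative. Together with each arc $\gamma$ one also considers its inverse arc $-\gamma(s)=\gamma(1-s)$ (so the collection of arcs is regarded as closed under inversion). It is assumed that $\gamma((0,1))\cap\gamma'([0,1])=\emptyset$ whenever $\gamma'\ne\gamma$, $\gamma'\neq-\gamma$. Vertices are the initial and terminal points of arcs; $\mathbf{V}$ is the set of vertices. The network is connected (any two vertices are linked by a finite concatenation of arcs) and has no loops ($\gamma(0)\ne\gamma(1)$ for every arc). For $x\in\mathbf{V}$, $\Gamma_x=\{\gamma : \gamma(1)=x\}$. Hamiltonians. Hamiltonians on $\Gamma$ are a family of functions $H_\gamma:[0,1]\times\mathbb{R}\to\mathbb{R}$ indexed by arcs, with $H_{-\gamma}(s,p)=H_\gamma(1-s,-p)$, such that each $H_\gamma$ is continuous in $(s,p)$, convex in $p$, coercive in $p$ uniformly in $s$, and for every $M>0$ there is $C_M$ with $H_\gamma(s,p)-H_\gamma(s,q)\le C_M|p-q|$ for all $s\in[0,1]$, $p,q\in(-M,M)$. Set $c_\gamma=-\max_{s\in[0,1]}\min_{p\in\mathbb{R}}H_\gamma(s,p)$. A flux limiter is a function $x\mapsto c_x$ from $\mathbf{V}$ to $\mathbb{R}$ with $c_x\le\min_{\gamma\in\Gamma_x}c_\gamma$ for all $x$. Equation. For $v:\Gamma\times[T_0,T_1)\to\mathbb{R}$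 put $(v\circ\gamma)(s,t)=v(\gamma(s),t)$; $'$ denotes the derivative in $s$ and subscript $t$ that in $t$. (HJ$_\gamma$) is $w_t+H_\gamma(s,w')=0$ in $(0,1)\times(T_0,T_1)$. A subtangent (resp. supertangent) to a function at a point is a $C^1$ function $\varphi$ such that (function $-\varphi$) has a local minimum (resp. maximum) at that point; it is constrained to a closed set $C$ if the point is a minimizer (resp. maximizer) only relative to a neighborhood of it intersected with $C$. A continuous $v:\Gamma\times[T_0,T_1)\to\mathbb{R}$ is a supersolution of (HJ$\Gamma$) in $(T_0,T_1)$ if (i) $v\circ\gamma$ is a viscosity supersolution of (HJ$_\gamma$) for every arc $\gamma$; (ii) for every $x\in\mathbf{V}$, $t_0\in(T_0,T_1)$: if some $C^1$ subtangent $\phi$ to $v(x,\cdot)$ at $t_0$ satisfies $\frac{d}{dt}\phi(t_0)<c_x$, then there is an arc $\gamma\in\Gamma_x$ such that all $C^1$ subtangents $\varphi$, constrained to $[0,1]\times\overline{(T_0,T_1)}$, to $v\circ\gamma$ at $(1,t_0)$ satisfy $\varphi_t(1,t_0)+H_\gamma(1,\varphi'(1,t_0))\ge0$. It is a subsolution of (HJ$\Gamma$) in $(T_0,T_1)$ if (i) $v\circ\gamma$ is a viscosity subsolution of (HJ$_\gamma$) for every arc $\gamma$; (ii) for every $x\in\mathbf{V}$, $t_0\in(T_0,T_1)$, all $C^1$ supertangents $\psi$ to $v(x,\cdot)$ at $t_0$ satisfy $\frac{d}{dt}\psi(t_0)\le c_x$. A solution is a continuous function that is both a subsolution and a supersolution.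 For every continuous initial datum and every flux limiter there is exactly one continuous solution of (HJ$\Gamma$) in $(T_0,T_1)$ attaining the datum at $t=T_0$; this is what "the continuous solution" refers to. *)

theory Defs
  imports "HOL-Analysis.Analysis"
begin

definition regular_C1_curve :: "(real \<Rightarrow> 'a::real_normed_vector) \<Rightarrow> bool" where
  "regular_C1_curve \<gamma> \<longleftrightarrow>
     (\<exists>\<gamma>'. continuous_on {0..1} \<gamma>' \<and>
       (\<forall>s\<in>{0..1}. (\<gamma> has_vector_derivative \<gamma>' s) (at s within {0..1}) \<and> \<gamma>' s \<noteq> 0))"

definition vertices :: "(real \<Rightarrow> 'a::topological_space) set \<Rightarrow> 'a set" where
  "vertices E = pathstart ` E \<union> pathfinish ` E"

definition support :: "(real \<Rightarrow> 'a::topological_space) set \<Rightarrow> 'a set" where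
  "support E = (\<Union>\<gamma>\<in>E. path_image \<gamma>)"

definition arcs_into :: "(real \<Rightarrow> 'a::topological_space) set \<Rightarrow> 'a \<Rightarrow> (real \<Rightarrow> 'a) set" where
  "arcs_into E x = {\<gamma> \<in> E. pathfinish \<gamma> = x}"

text \<open>
  An arc is a total function of which only the restriction to the unit interval matters.
  The condition \<open>interior_disjoint\<close> excludes two different elements of \<open>E\<close> that agree on
  the unit interval, so every geometric arc has a single representative in \<open>E\<close>, and
  equality in \<open>E\<close> is equality of arcs.
\<close>

locale network =
  fixes E :: "(real \<Rightarrow> 'a::euclidean_space) set"
  assumes finite_arcs: "finite E"
    and simple: "\<gamma> \<in> E \<Longrightarrow> simple_path \<gamma>"
    and regular: "\<gamma> \<in> E \<Longrightarrow> regular_C1_curve \<gamma>"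
    and inverse_arc: "\<gamma> \<in> E \<Longrightarrow> reversepath \<gamma> \<in> E"
    and interior_disjoint:
      "\<gamma> \<in> E \<Longrightarrow> \<delta> \<in> E \<Longrightarrow> \<delta> \<noteq> \<gamma> \<Longrightarrow> \<delta> \<noteq> reversepath \<gamma> \<Longrightarrow>
         \<gamma> ` {0<..<1} \<inter> \<delta> ` {0..1} = {}"
    and no_loops: "\<gamma> \<in> E \<Longrightarrow> pathstart \<gamma> \<noteq> pathfinish \<gamma>"
    and connected_arcs:
      "x \<in> vertices E \<Longrightarrow> y \<in> vertices E \<Longrightarrow>
         (x, y) \<in> {(pathstart \<gamma>, pathfinish \<gamma>) |\<gamma>. \<gamma> \<in> E}\<^sup>*"

text \<open>
  A family of Hamiltonians is a function \<open>H\<close> with \<open>H \<gamma> (s, p)\<close> relevant only for \<open>\<gamma> \<in> E\<close>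
  and \<open>s\<close> in the unit interval.
\<close>

locale hamiltonians =
  fixes E :: "(real \<Rightarrow> 'a::euclidean_space) set"
    and H :: "(real \<Rightarrow> 'a) \<Rightarrow> real \<times> real \<Rightarrow> real"
  assumes inverse_arc_eq:
      "\<gamma> \<in> E \<Longrightarrow> s \<in> {0..1} \<Longrightarrow> H (reversepath \<gamma>) (s, p) = H \<gamma> (1 - s, - p)"
    and continuous: "\<gamma> \<in> E \<Longrightarrow> continuous_on ({0..1} \<times> UNIV) (H \<gamma>)"
    and convex: "\<gamma> \<in> E \<Longrightarrow> s \<in> {0..1} \<Longrightarrow> convex_on UNIV (\<lambda>p. H \<gamma> (s, p))"
    and coercive: "\<gamma> \<in> E \<Longrightarrow> \<exists>R. \<forall>s\<in>{0..1}. \<forall>p. R \<le> \<bar>p\<bar> \<longrightarrow> K \<le> H \<gamma> (s, p)"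
    and locally_lipschitz:
      "\<gamma> \<in> E \<Longrightarrow> 0 < M \<Longrightarrow>
         \<exists>C. \<forall>s\<in>{0..1}. \<forall>p\<in>{-M<..<M}. \<forall>q\<in>{-M<..<M}.
           H \<gamma> (s, p) - H \<gamma> (s, q) \<le> C * \<bar>p - q\<bar>"

text \<open>
  For continuous coercive Hamiltonians both extrema are attained, so that \<open>SUP\<close> and \<open>INF\<close>
  are the maximum over \<open>s\<close> and the minimum over \<open>p\<close>.
\<close>

definition arc_constant ::
    "((real \<Rightarrow> 'a) \<Rightarrow> real \<times> real \<Rightarrow> real) \<Rightarrow> (real \<Rightarrow> 'a) \<Rightarrow> real" where
  "arc_constant H \<gamma> = - (SUP s\<in>{0..1}. INF p. H \<gamma> (s, p))"

definition flux_limiter ::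
    "(real \<Rightarrow> 'a::topological_space) set \<Rightarrow> ((real \<Rightarrow> 'a) \<Rightarrow> real \<times> real \<Rightarrow> real) \<Rightarrow>
     ('a \<Rightarrow> real) \<Rightarrow> bool" where
  "flux_limiter E H c \<longleftrightarrow> (\<forall>x\<in>vertices E. c x \<le> (MIN \<gamma>\<in>arcs_into E x. arc_constant H \<gamma>))"

definition C1_fun :: "('b::real_normed_vector \<Rightarrow> real) \<Rightarrow> bool" where
  "C1_fun \<phi> \<longleftrightarrow>
     (\<exists>\<phi>' :: 'b \<Rightarrow> 'b \<Rightarrow>\<^sub>L real. continuous_on UNIV \<phi>' \<and>
       (\<forall>z. (\<phi> has_derivative blinfun_apply (\<phi>' z)) (at z)))"

text \<open>
  Contact relative to \<open>C\<close>. At an interior point of \<open>C\<close> this is ordinary local contact; at a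
  boundary point it is the constrained notion.
\<close>

definition subtangent ::
    "'b::real_normed_vector set \<Rightarrow> ('b \<Rightarrow> real) \<Rightarrow> 'b \<Rightarrow> ('b \<Rightarrow> real) \<Rightarrow> bool" where
  "subtangent C f z \<phi> \<longleftrightarrow>
     C1_fun \<phi> \<and> (\<forall>\<^sub>F y in at z within C. f z - \<phi> z \<le> f y - \<phi> y)"

definition supertangent ::
    "'b::real_normed_vector set \<Rightarrow> ('b \<Rightarrow> real) \<Rightarrow> 'b \<Rightarrow> ('b \<Rightarrow> real) \<Rightarrow> bool" where
  "supertangent C f z \<phi> \<longleftrightarrow>
     C1_fun \<phi> \<and> (\<forall>\<^sub>F y in at z within C. f y - \<phi> y \<le> f z - \<phi> z)"

text \<open>The final time is extended real, in order to allow an infinite horizon.\<close>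

definition time_interval :: "real \<Rightarrow> ereal \<Rightarrow> real set" where
  "time_interval T0 T1 = {t. T0 \<le> t \<and> ereal t < T1}"

definition open_time_interval :: "real \<Rightarrow> ereal \<Rightarrow> real set" where
  "open_time_interval T0 T1 = {t. T0 < t \<and> ereal t < T1}"

text \<open>The left-hand side \<open>\<phi>\<^sub>t + h (s, \<phi>')\<close> of the equation on an arc with Hamiltonian \<open>h\<close>.\<close>

definition hj_operator ::
    "(real \<times> real \<Rightarrow> real) \<Rightarrow> (real \<times> real \<Rightarrow> real) \<Rightarrow> real \<Rightarrow> real \<Rightarrow> real" where
  "hj_operator h \<phi> s t = deriv (\<lambda>\<tau>. \<phi> (s, \<tau>)) t + h (s, deriv (\<lambda>\<sigma>. \<phi> (\<sigma>, t)) s)"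

definition arc_supersolution ::
    "(real \<times> real \<Rightarrow> real) \<Rightarrow> real \<Rightarrow> ereal \<Rightarrow> (real \<times> real \<Rightarrow> real) \<Rightarrow> bool" where
  "arc_supersolution h T0 T1 w \<longleftrightarrow>
     (\<forall>s\<in>{0<..<1}. \<forall>t\<in>open_time_interval T0 T1. \<forall>\<phi>.
        subtangent ({0<..<1} \<times> open_time_interval T0 T1) w (s, t) \<phi> \<longrightarrow> 0 \<le> hj_operator h \<phi> s t)"

definition arc_subsolution ::
    "(real \<times> real \<Rightarrow> real) \<Rightarrow> real \<Rightarrow> ereal \<Rightarrow> (real \<times> real \<Rightarrow> real) \<Rightarrow> bool" where
  "arc_subsolution h T0 T1 w \<longleftrightarrow>
     (\<forall>s\<in>{0<..<1}. \<forall>t\<in>open_time_interval T0 T1. \<forall>\<phi>.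
        supertangent ({0<..<1} \<times> open_time_interval T0 T1) w (s, t) \<phi> \<longrightarrow> hj_operator h \<phi> s t \<le> 0)"

definition along :: "('a \<times> real \<Rightarrow> real) \<Rightarrow> (real \<Rightarrow> 'a) \<Rightarrow> real \<times> real \<Rightarrow> real" where
  "along v \<gamma> = (\<lambda>(s, t). v (\<gamma> s, t))"

definition hj_supersolution ::
    "(real \<Rightarrow> 'a::euclidean_space) set \<Rightarrow> ((real \<Rightarrow> 'a) \<Rightarrow> real \<times> real \<Rightarrow> real) \<Rightarrow>
     ('a \<Rightarrow> real) \<Rightarrow> real \<Rightarrow> ereal \<Rightarrow> ('a \<times> real \<Rightarrow> real) \<Rightarrow> bool" where
  "hj_supersolution E H c T0 T1 v \<longleftrightarrow>
     continuous_on (support E \<times> time_interval T0 T1) v \<and>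
     (\<forall>\<gamma>\<in>E. arc_supersolution (H \<gamma>) T0 T1 (along v \<gamma>)) \<and>
     (\<forall>x\<in>vertices E. \<forall>t\<in>open_time_interval T0 T1.
        (\<exists>\<phi>. subtangent (open_time_interval T0 T1) (\<lambda>\<tau>. v (x, \<tau>)) t \<phi> \<and> deriv \<phi> t < c x) \<longrightarrow>
        (\<exists>\<gamma>\<in>arcs_into E x. \<forall>\<phi>.
           subtangent ({0..1} \<times> closure (open_time_interval T0 T1)) (along v \<gamma>) (1, t) \<phi> \<longrightarrow>
           0 \<le> hj_operator (H \<gamma>) \<phi> 1 t))"

definition hj_subsolution ::
    "(real \<Rightarrow> 'a::euclidean_space) set \<Rightarrow> ((real \<Rightarrow> 'a) \<Rightarrow> real \<times> real \<Rightarrow> real) \<Rightarrow>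
     ('a \<Rightarrow> real) \<Rightarrow> real \<Rightarrow> ereal \<Rightarrow> ('a \<times> real \<Rightarrow> real) \<Rightarrow> bool" where
  "hj_subsolution E H c T0 T1 v \<longleftrightarrow>
     continuous_on (support E \<times> time_interval T0 T1) v \<and>
     (\<forall>\<gamma>\<in>E. arc_subsolution (H \<gamma>) T0 T1 (along v \<gamma>)) \<and>
     (\<forall>x\<in>vertices E. \<forall>t\<in>open_time_interval T0 T1. \<forall>\<psi>.
        supertangent (open_time_interval T0 T1) (\<lambda>\<tau>. v (x, \<tau>)) t \<psi> \<longrightarrow> deriv \<psi> t \<le> c x)"

definition hj_solution ::
    "(real \<Rightarrow> 'a::euclidean_space) set \<Rightarrow> ((real \<Rightarrow> 'a) \<Rightarrow> real \<times> real \<Rightarrow> real) \<Rightarrow>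
     ('a \<Rightarrow> real) \<Rightarrow> real \<Rightarrow> ereal \<Rightarrow> ('a \<times> real \<Rightarrow> real) \<Rightarrow> bool" where
  "hj_solution E H c T0 T1 v \<longleftrightarrow> hj_subsolution E H c T0 T1 v \<and> hj_supersolution E H c T0 T1 v"

text \<open>Locally uniform convergence is uniform convergence on compact subsets.\<close>

definition locally_uniform_limit ::
    "'b::topological_space set \<Rightarrow> (nat \<Rightarrow> 'b \<Rightarrow> real) \<Rightarrow> ('b \<Rightarrow> real) \<Rightarrow> bool" where
  "locally_uniform_limit D f l \<longleftrightarrow>
     (\<forall>K. compact K \<and> K \<subseteq> D \<longrightarrow> uniform_limit K f l sequentially)"

end

theory Submission
  imports Defs
begin

text \<open>
  Both \<open>u\<^sub>n\<close> and \<open>u\<close> are sub- and supersolutions of nearby problems, so the convergence follows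
  from a quantitative comparison principle: if \<open>H' \<le> H + \<kappa>\<close> and \<open>c \<le> c' + \<kappa>\<close>, a subsolution \<open>u\<close>
  for \<open>(H, c)\<close> and a supersolution \<open>v\<close> for \<open>(H', c')\<close> satisfy
  \<open>u - v \<le> sup (u - v) (\<cdot>, T0) + \<kappa> (t - T0)\<close>.

  For the comparison only the time variable is doubled on the network: one maximizes
  \<open>u (x, t) - v (x, t') - P t - K (t - t')\<^sup>2\<close> with \<open>P' > \<kappa>\<close>. At a maximizer whose \<open>x\<close> is a vertex,
  a supporting line of the convex Hamiltonian turns the subsolution property of \<open>u\<close> on the arc
  selected by the supersolution property of \<open>v\<close> into an estimate along a characteristic ending
  at the vertex, and this estimate produces a subtangent to \<open>v\<close> violating the equation.
  If no maximizer lies over a vertex, the space variable is doubled as well on an arc; since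
  \<open>K\<close> is fixed, the time slope of the test functions is bounded, and coercivity bounds their
  space slope, without any Lipschitz regularization of \<open>u\<close>.
\<close>

section \<open>Test functions\<close>

text \<open>The test functions below are sums of one-variable functions of linear forms, so this
  rule and \<open>C1_fun_add\<close> cover all of them.\<close>

lemma C1_fun_compose_linear:
  fixes l :: "'b::real_normed_vector \<Rightarrow> real"
  assumes l: "bounded_linear l"
    and f: "\<And>x. (f has_real_derivative f' x) (at x)" and f': "continuous_on UNIV f'"
  shows "C1_fun (\<lambda>z. f (l z))"
proof -
  define D where "D z = f' (l z) *\<^sub>R Blinfun l" for z
  have "continuous_on UNIV D"
    unfolding D_def
    by (intro continuous_intros continuous_on_compose2[OF f'] linear_continuous_on l) auto
  moreover have "((\<lambda>z. f (l z)) has_derivative blinfun_apply (D z)) (at z)" for z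
  proof -
    have "(f has_derivative (\<lambda>h. f' (l z) * h)) (at (l z))"
      using f[of "l z"] by (simp add: has_field_derivative_def)
    from has_derivative_compose[OF bounded_linear_imp_has_derivative[OF l] this]
    have "((\<lambda>z. f (l z)) has_derivative (\<lambda>h. f' (l z) * l h)) (at z)" .
    then show ?thesis
      by (rule has_derivative_eq_rhs)
        (simp add: fun_eq_iff D_def blinfun.scaleR_left bounded_linear_Blinfun_apply[OF l])
  qed
  ultimately show ?thesis
    unfolding C1_fun_def by blast
qed

lemma C1_fun_add:
  assumes "C1_fun f" "C1_fun g"
  shows "C1_fun (\<lambda>z. f z + g z)"
proof -
  obtain f' where f': "continuous_on UNIV f'" "\<And>z. (f has_derivative blinfun_apply (f' z)) (at z)"
    using assms(1) by (auto simp: C1_fun_def)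
  obtain g' where g': "continuous_on UNIV g'" "\<And>z. (g has_derivative blinfun_apply (g' z)) (at z)"
    using assms(2) by (auto simp: C1_fun_def)
  have "((\<lambda>z. f z + g z) has_derivative blinfun_apply (f' z + g' z)) (at z)" for z
    by (rule has_derivative_eq_rhs[OF has_derivative_add[OF f'(2) g'(2)]])
      (simp add: fun_eq_iff blinfun.add_left)
  then show ?thesis
    unfolding C1_fun_def
    by (intro exI[of _ "\<lambda>z. f' z + g' z"] conjI continuous_on_add f'(1) g'(1)) auto
qed

lemma hj_operator_eq:
  assumes "((\<lambda>\<tau>. \<phi> (s, \<tau>)) has_real_derivative q) (at t)"
    and "((\<lambda>\<sigma>. \<phi> (\<sigma>, t)) has_real_derivative p) (at s)"
  shows "hj_operator h \<phi> s t = q + h (s, p)"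
  using assms by (simp add: hj_operator_def DERIV_imp_deriv)

lemma eventually_at_withinI:
  assumes "open S" "z \<in> S" "\<And>y. y \<in> S \<Longrightarrow> y \<in> C \<Longrightarrow> Q y"
  shows "\<forall>\<^sub>F y in at z within C. Q y"
  using assms unfolding eventually_at_topological by blast

lemma subtangentI:
  assumes "C1_fun \<phi>" "open S" "z \<in> S" "\<And>y. y \<in> S \<Longrightarrow> y \<in> C \<Longrightarrow> f z - \<phi> z \<le> f y - \<phi> y"
  shows "subtangent C f z \<phi>"
  using assms(1) eventually_at_withinI[OF assms(2-4)] by (simp add: subtangent_def)

lemma supertangentI:
  assumes "C1_fun \<phi>" "open S" "z \<in> S" "\<And>y. y \<in> S \<Longrightarrow> y \<in> C \<Longrightarrow> f y - \<phi> y \<le> f z - \<phi> z"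
  shows "supertangent C f z \<phi>"
  using assms(1) eventually_at_withinI[OF assms(2-4)] by (simp add: supertangent_def)

section \<open>Penalization\<close>

text \<open>If no penalty worked, each \<open>n\<close> would give a point where
  \<open>F - n * d\<close> is at least \<open>m\<close>. Boundedness of \<open>F\<close> then forces
  \<open>d\<close> to 0 along a convergent subsequence, whose limit contradicts \<open>less\<close>.
  The result is one finite constant, so no limit in the penalty parameter is taken later.\<close>

lemma penalization:
  fixes F d :: "'b::metric_space \<Rightarrow> real"
  assumes B: "compact B" and F: "continuous_on B F" and d: "continuous_on B d"
    and pos: "\<And>z. z \<in> B \<Longrightarrow> 0 \<le> d z"
    and less: "\<And>z. z \<in> B \<Longrightarrow> d z = 0 \<Longrightarrow> F z < m"
  obtains n :: real where "0 \<le> n" "\<And>z. z \<in> B \<Longrightarrow> F z - n * d z < m"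
proof (rule ccontr)
  assume "\<not> thesis"
  then have "\<exists>z\<in>B. m \<le> F z - real n * d z" for n
    using that[of "real n"] by force
  then obtain z where z: "\<And>n. z n \<in> B" "\<And>n. m \<le> F (z n) - real n * d (z n)"
    by metis
  obtain z0 r where r: "z0 \<in> B" "strict_mono r" "(z \<circ> r) \<longlonglongrightarrow> z0"
    using B z(1) unfolding compact_def by meson
  have limF: "(\<lambda>n. F (z (r n))) \<longlonglongrightarrow> F z0" and limd: "(\<lambda>n. d (z (r n))) \<longlonglongrightarrow> d z0"
    using continuous_on_tendsto_compose[OF F r(3) r(1)] continuous_on_tendsto_compose[OF d r(3) r(1)] z(1)
    by (auto simp: o_def)
  obtain C where C: "\<And>z. z \<in> B \<Longrightarrow> F z \<le> C"
    using continuous_attains_sup[OF B _ F] r(1) by (metis empty_iff)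
  have "d (z (r n)) \<le> (C - m) * inverse (real n)" if "0 < n" for n
  proof -
    have "real n * d (z (r n)) \<le> real (r n) * d (z (r n))"
      using seq_suble[OF r(2), of n] pos[OF z(1)] by (intro mult_right_mono) auto
    also have "\<dots> \<le> C - m"
      using z(2)[of "r n"] C[OF z(1), of "r n"] by linarith
    finally show ?thesis
      using that by (simp add: field_simps)
  qed
  then have "\<forall>\<^sub>F n in sequentially. d (z (r n)) \<le> (C - m) * inverse (real n)"
    by (auto simp: eventually_sequentially intro!: exI[of _ 1])
  moreover have "(\<lambda>n. (C - m) * inverse (real n)) \<longlonglongrightarrow> 0"
    by (intro tendsto_mult_right_zero lim_inverse_n)
  ultimately have "d z0 \<le> 0"
    by (rule tendsto_le[OF sequentially_bot, rotated 2, OF _ ]) (rule limd)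
  moreover have "m \<le> F (z (r n))" for n
    using z(2)[of "r n"] mult_nonneg_nonneg[OF of_nat_0_le_iff[of "r n"] pos[OF z(1)[of "r n"]]]
    by linarith
  then have "m \<le> F z0"
    using limF by (intro LIMSEQ_le_const) auto
  ultimately show False
    using less[OF r(1)] pos[OF r(1)] by force
qed

text \<open>Keeps maxima inside a time interval: \<open>g\<close> costs little at the chosen time
  \<open>t1\<close>, its size at \<open>t2\<close> excludes the final time, and
  \<open>0 < g'\<close> makes the viscosity inequality strict.\<close>

lemma exponential_barrier:
  fixes t1 t2 \<delta> C :: real
  assumes "t1 < t2" "0 < \<delta>"
  obtains g g' where "\<And>t. (g has_real_derivative g' t) (at t)" "continuous_on UNIV g'"
    "\<And>t. 0 < g t" "mono g'" "\<And>t. 0 < g' t" "g t1 < \<delta>" "C < g t2"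
proof -
  \<comment> \<open>With this rate, \<open>1 + x \<le> exp x\<close> already yields
    \<open>\<delta> + \<bar>C\<bar> \<le> g t2\<close>.\<close>
  define B where "B = (2 * \<bar>C\<bar> / \<delta> + 1) / (t2 - t1)"
  define g where "g t = \<delta> / 2 * exp (B * (t - t1))" for t
  define g' where "g' t = \<delta> / 2 * (B * exp (B * (t - t1)))" for t
  have B: "0 < B"
    using assms by (auto simp: B_def intro!: divide_pos_pos add_nonneg_pos)
  show thesis
  proof
    show "(g has_real_derivative g' t) (at t)" for t
      unfolding g_def g'_def by (auto intro!: derivative_eq_intros)
    show "continuous_on UNIV g'"
      unfolding g'_def by (intro continuous_intros)
    show "0 < g t" "0 < g' t" for t
      using B assms by (auto simp: g_def g'_def)
    show "mono g'"
      using B assms by (auto simp: g'_def intro!: monoI mult_left_mono)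
    show "g t1 < \<delta>"
      using assms by (simp add: g_def)
    have "B * (t2 - t1) = 2 * \<bar>C\<bar> / \<delta> + 1"
      using assms by (simp add: B_def)
    then have "\<delta> / 2 * (1 + B * (t2 - t1)) = \<delta> + \<bar>C\<bar>"
      using assms by (simp add: field_simps)
    then have "C < \<delta> / 2 * (1 + B * (t2 - t1))"
      using assms by linarith
    also have "\<dots> \<le> g t2"
      unfolding g_def using assms by (intro mult_left_mono exp_ge_add_one_self) auto
    finally show "C < g t2" .
  qed
qed

section \<open>Subsolutions along characteristics\<close>

text \<open>
  The lower bound on the Hamiltonian makes \<open>w\<close> a viscosity subsolution of the linear transport
  equation \<open>w\<^sub>t + \<mu> w' = L\<close>. If the estimate failed, then \<open>w - L t\<close>, minus a barrier that is
  strictly increasing in time and minus a large multiple of the squared distance to the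
  characteristic, would have an interior maximum.
\<close>

lemma arc_subsolution_interior_transport:
  assumes sub: "arc_subsolution h T0 T1 w"
    and cont: "continuous_on ({0..1} \<times> time_interval T0 T1) w"
    and h: "\<And>s p. s \<in> {a..1} \<Longrightarrow> \<mu> * p - L \<le> h (s, p)"
    and "0 \<le> a" "a < s1" "s2 < 1" "0 < \<mu>" "T0 < t1" "t1 < t2" "ereal t2 < T1"
    and eq: "s2 - s1 = \<mu> * (t2 - t1)"
  shows "w (s2, t2) \<le> w (s1, t1) + L * (t2 - t1)"
proof (rule ccontr)
  assume contra: "\<not> ?thesis"
  define y where "y t = s1 + \<mu> * (t - t1)" for t
  define f where "f t = w (y t, t) - L * (t - t1)" for t
  have y: "y t1 = s1" "y t2 = s2"
    using eq by (auto simp: y_def)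
  have "mono y"
    using \<open>0 < \<mu>\<close> by (auto simp: y_def intro!: monoI mult_left_mono)
  then have y_in: "s1 \<le> y t" "y t \<le> s2" if "t \<in> {t1..t2}" for t
    using that y by (auto dest: monoD)
  have box: "{s1..s2} \<subseteq> {0..1}" "{t1..t2} \<subseteq> time_interval T0 T1"
    using assms by (auto simp: time_interval_def intro: order_le_less_trans[of _ "ereal t2"])
  have "continuous_on {t1..t2} (\<lambda>t. w (y t, t))"
  proof (rule continuous_on_compose2[OF cont])
    show "continuous_on {t1..t2} (\<lambda>t. (y t, t))"
      unfolding y_def by (intro continuous_intros)
    show "(\<lambda>t. (y t, t)) ` {t1..t2} \<subseteq> {0..1} \<times> time_interval T0 T1"
    proof (rule image_subsetI)
      fix t assume t: "t \<in> {t1..t2}"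
      then have "y t \<in> {s1..s2}"
        using y_in by simp
      then show "(y t, t) \<in> {0..1} \<times> time_interval T0 T1"
        using box t by blast
    qed
  qed
  then have "continuous_on {t1..t2} f"
    unfolding f_def by (intro continuous_intros)
  moreover have f12: "f t1 < f t2"
    using contra y \<open>t1 < t2\<close> by (simp add: f_def)
  \<comment> \<open>The excess at \<open>t2\<close> persists slightly earlier. The comparison point
    needs an earlier time because the barrier will exclude \<open>t2\<close>.\<close>
  ultimately have "\<forall>\<^sub>F t in at_left t2. f t1 < f t"
    using \<open>t1 < t2\<close> by (intro order_tendstoD(1)[of f "f t2"])
      (auto simp: continuous_on_def at_within_Icc_at_left dest: bspec[of _ _ t2])
  moreover have "\<forall>\<^sub>F t in at_left t2. t \<in> {t1<..<t2}"
    using \<open>t1 < t2\<close> by (rule eventually_at_left_real)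
  ultimately obtain th where th: "f t1 < f th" "th \<in> {t1<..<t2}"
    using eventually_happens'[OF trivial_limit_at_left_real eventually_conj] by blast
  \<comment> \<open>The margins keep the characteristic off the lateral sides, while the box stays
    inside \<open>{a..1}\<close>, where the bound on \<open>h\<close> holds, and away from
    \<open>s = 1\<close>.\<close>
  define B where "B = {(a + s1) / 2..(s2 + 1) / 2} \<times> {t1..t2}"
  have s12: "s1 < s2"
    using eq \<open>0 < \<mu>\<close> \<open>t1 < t2\<close> by (metis diff_gt_0_iff_gt mult_pos_pos)
  have B: "compact B" "B \<subseteq> {0..1} \<times> time_interval T0 T1"
    using box assms s12 by (auto simp: B_def intro!: compact_Times)
  have contB: "continuous_on B w"
    using continuous_on_subset[OF cont B(2)] .
  define G where "G z = w z - L * (snd z - t1)" for z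
  have contG: "continuous_on B G"
    unfolding G_def by (intro continuous_intros contB)
  have curve_in: "(y t, t) \<in> B" if "t \<in> {t1..t2}" for t
    using y_in[OF that] that assms by (auto simp: B_def)
  have "(y th, th) \<in> B"
    using curve_in th(2) by simp
  then have "B \<noteq> {}" by blast
  obtain C where C: "\<And>z. z \<in> B \<Longrightarrow> G z \<le> C"
    using continuous_attains_sup[OF B(1) \<open>B \<noteq> {}\<close> contG] by blast
  \<comment> \<open>The barrier at \<open>th\<close> is below the gain \<open>f th - f t1\<close>,
    and at \<open>t2\<close> it exceeds every value of \<open>G - f t1\<close>; hence
    \<open>F\<close> is below \<open>m\<close> at both ends of the characteristic.\<close>
  obtain g g' where g: "\<And>t. (g has_real_derivative g' t) (at t)" "continuous_on UNIV g'"
    "\<And>t. 0 < g t" "\<And>t. 0 < g' t" "g th < f th - f t1" "C - f t1 < g t2"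
    by (rule exponential_barrier[of th t2 "f th - f t1" "C - f t1"]) (use th in auto)
  have contg: "continuous_on S g" for S
    using g(1) by (meson DERIV_isCont continuous_at_imp_continuous_on)
  define F where "F z = G z - g (snd z)" for z
  define d where "d z = (fst z - y (snd z))^2" for z
  have contF: "continuous_on B F" and contd: "continuous_on B d"
    unfolding F_def d_def y_def
    by (intro continuous_intros contG continuous_on_compose2[OF contg[of UNIV]]; auto)+
  define m where "m = f th - g th"
  \<comment> \<open>On this boundary \<open>d\<close> vanishes only at the two ends of the
    characteristic.\<close>
  define Bd where "Bd = B - {(a + s1) / 2<..<(s2 + 1) / 2} \<times> {t1<..<t2}"
  have Bd: "compact Bd" "Bd \<subseteq> B"
    unfolding Bd_def by (auto intro!: compact_diff B(1) open_Times)
  have less: "F z < m" if "z \<in> Bd" "d z = 0" for z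
  proof -
    obtain s t where st: "z = (s, t)" by force
    have s: "s = y t" and "t \<in> {t1..t2}"
      using that st Bd(2) by (auto simp: d_def B_def)
    then have "t = t1 \<or> t = t2"
      using that st y_in[of t] s12 assms by (auto simp: Bd_def B_def)
    moreover have "F (y t1, t1) < m"
      using th g(5) g(3)[of t1] by (simp add: F_def G_def m_def f_def)
    moreover have "F (y t2, t2) < m"
      using th g(5,6) C[OF curve_in[of t2]] \<open>t1 < t2\<close> by (simp add: F_def m_def)
    ultimately show ?thesis
      using s st by auto
  qed
  have "0 \<le> d z" for z
    by (simp add: d_def)
  then obtain n where n: "\<And>z. z \<in> Bd \<Longrightarrow> F z - n * d z < m"
    using penalization[OF Bd(1) continuous_on_subset[OF contF Bd(2)] continuous_on_subset[OF contd Bd(2)] _ less]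
    by blast
  have "continuous_on B (\<lambda>z. F z - n * d z)"
    by (intro continuous_intros contF contd)
  then obtain z where z: "z \<in> B" "\<And>z'. z' \<in> B \<Longrightarrow> F z' - n * d z' \<le> F z - n * d z"
    using continuous_attains_sup[OF B(1) \<open>B \<noteq> {}\<close>] by blast
  have "m \<le> F z - n * d z"
    using z(2)[OF \<open>(y th, th) \<in> B\<close>] by (simp add: m_def F_def G_def d_def f_def)
  then have "z \<notin> Bd"
    using n[of z] by auto
  then obtain s t where st: "z = (s, t)" and s: "(a + s1) / 2 < s" "s < (s2 + 1) / 2" and t: "t1 < t" "t < t2"
    using z(1) by (cases z) (auto simp: Bd_def)
  define \<phi> where "\<phi> z = (L * (snd z - t1) + g (snd z)) + n * ((fst z - \<mu> * snd z) - s1 + \<mu> * t1)^2" for z :: "real \<times> real"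
  have C1: "C1_fun \<phi>"
    unfolding \<phi>_def
  proof (intro C1_fun_add)
    show "C1_fun (\<lambda>z::real\<times>real. L * (snd z - t1))"
      by (rule C1_fun_compose_linear[OF bounded_linear_snd, of "\<lambda>x. L * (x - t1)" "\<lambda>x. L"])
        (auto intro!: derivative_eq_intros)
    show "C1_fun (\<lambda>z::real\<times>real. g (snd z))"
      by (rule C1_fun_compose_linear[OF bounded_linear_snd g(1,2)])
    have "bounded_linear (\<lambda>z::real\<times>real. fst z - \<mu> * snd z)"
      by (intro bounded_linear_sub bounded_linear_fst bounded_linear_const_mult bounded_linear_snd)
    then show "C1_fun (\<lambda>z::real\<times>real. n * ((fst z - \<mu> * snd z) - s1 + \<mu> * t1)^2)"
      by (rule C1_fun_compose_linear[of _ "\<lambda>x. n * (x - s1 + \<mu> * t1)^2" "\<lambda>x. n * (2 * (x - s1 + \<mu> * t1))"])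
        (auto intro!: derivative_eq_intros continuous_intros)
  qed
  have "supertangent ({0<..<1} \<times> open_time_interval T0 T1) w (s, t) \<phi>"
  proof (rule supertangentI[OF C1])
    show "open ({(a + s1) / 2<..<(s2 + 1) / 2} \<times> {t1<..<t2})"
      by (intro open_Times) auto
    show "(s, t) \<in> {(a + s1) / 2<..<(s2 + 1) / 2} \<times> {t1<..<t2}"
      using s t by auto
    fix z' assume "z' \<in> {(a + s1) / 2<..<(s2 + 1) / 2} \<times> {t1<..<t2}"
    then have "z' \<in> B" by (auto simp: B_def)
    from z(2)[OF this] show "w z' - \<phi> z' \<le> w (s, t) - \<phi> (s, t)"
      by (simp add: st F_def G_def d_def \<phi>_def y_def algebra_simps)
  qed
  moreover have "s \<in> {0<..<1}" "t \<in> open_time_interval T0 T1"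
    using s t assms less_trans[of "ereal t" "ereal t2" T1] by (auto simp: open_time_interval_def)
  ultimately have "hj_operator h \<phi> s t \<le> 0"
    using sub by (auto simp: arc_subsolution_def)
  \<comment> \<open>The penalty is constant along characteristics: it adds \<open>p\<close> to the
    space slope and \<open>- \<mu> * p\<close> to the time slope. These cancel in the lower bound
    for \<open>h\<close>, leaving at least \<open>g' t\<close>.\<close>
  moreover define p where "p = n * (2 * ((s - \<mu> * t) - s1 + \<mu> * t1))"
  have "hj_operator h \<phi> s t = (L + g' t - \<mu> * p) + h (s, p)"
    unfolding \<phi>_def p_def
    by (rule hj_operator_eq) (auto intro!: derivative_eq_intros g(1) simp: algebra_simps)
  moreover have "\<mu> * p - L \<le> h (s, p)"
    using h s assms by auto
  ultimately show False
    using g(4)[of t] by linarith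
qed

text \<open>\<open>arc_subsolution\<close> speaks only of \<open>s\<close> in the open interval, so
  the endpoint is reached by following the characteristic to \<open>\<sigma> < 1\<close> and letting
  \<open>\<sigma>\<close> tend to 1, by continuity of \<open>w\<close>.\<close>

lemma arc_subsolution_transport:
  assumes sub: "arc_subsolution h T0 T1 w"
    and cont: "continuous_on ({0..1} \<times> time_interval T0 T1) w"
    and h: "\<And>s p. s \<in> {a..1} \<Longrightarrow> \<mu> * p - L \<le> h (s, p)"
    and "0 \<le> a" "a < s" "s \<le> 1" "0 < \<mu>" "T0 < t - (1 - s) / \<mu>" "ereal t < T1"
  shows "w (1, t) \<le> w (s, t - (1 - s) / \<mu>) + L * (1 - s) / \<mu>"
proof (cases "s = 1")
  case False
  then have s: "s < 1" using assms by simp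
  \<comment> \<open>The time at which the characteristic of speed \<open>\<mu>\<close> ending at
    \<open>(1, t)\<close> passes \<open>\<sigma>\<close>.\<close>
  define \<tau> where "\<tau> \<sigma> = t - (1 - \<sigma>) / \<mu>" for \<sigma>
  have \<tau>: "\<tau> \<sigma> - \<tau> \<sigma>' = (\<sigma> - \<sigma>') / \<mu>" for \<sigma> \<sigma>'
    using \<open>0 < \<mu>\<close> by (simp add: \<tau>_def field_simps)
  have \<tau>_in: "T0 < \<tau> \<sigma>" "ereal (\<tau> \<sigma>) < T1" if "\<sigma> \<in> {s..1}" for \<sigma>
  proof -
    have "0 \<le> (\<sigma> - s) / \<mu>"
      using that \<open>0 < \<mu>\<close> by simp
    then have "\<tau> s \<le> \<tau> \<sigma>"
      using \<tau>[of \<sigma> s] by linarith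
    then show "T0 < \<tau> \<sigma>"
      using assms by (simp add: \<tau>_def)
    have "\<tau> \<sigma> \<le> t"
      using that \<open>0 < \<mu>\<close> by (simp add: \<tau>_def)
    then show "ereal (\<tau> \<sigma>) < T1"
      using \<open>ereal t < T1\<close> le_less_trans[of "ereal (\<tau> \<sigma>)" "ereal t" T1] by simp
  qed
  have "continuous_on {s..1} (\<lambda>\<sigma>. w (\<sigma>, \<tau> \<sigma>))"
  proof (rule continuous_on_compose2[OF cont])
    show "continuous_on {s..1} (\<lambda>\<sigma>. (\<sigma>, \<tau> \<sigma>))"
      unfolding \<tau>_def using assms by (intro continuous_intros) auto
    show "(\<lambda>\<sigma>. (\<sigma>, \<tau> \<sigma>)) ` {s..1} \<subseteq> {0..1} \<times> time_interval T0 T1"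
      using \<tau>_in assms by (auto simp: time_interval_def less_imp_le)
  qed
  then have lim: "((\<lambda>\<sigma>. w (\<sigma>, \<tau> \<sigma>)) \<longlongrightarrow> w (1, \<tau> 1)) (at_left 1)"
    by (rule continuous_on_Icc_at_leftD[OF _ s])
  have limR: "((\<lambda>\<sigma>. w (s, \<tau> s) + L * ((\<sigma> - s) / \<mu>)) \<longlongrightarrow> w (s, \<tau> s) + L * ((1 - s) / \<mu>)) (at_left 1)"
    using \<open>0 < \<mu>\<close> by (intro tendsto_intros) auto
  have "\<forall>\<^sub>F \<sigma> in at_left 1. w (\<sigma>, \<tau> \<sigma>) \<le> w (s, \<tau> s) + L * ((\<sigma> - s) / \<mu>)"
    using eventually_at_left_real[OF s]
  proof eventually_elim
    case (elim \<sigma>)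
    then have "\<tau> s < \<tau> \<sigma>"
      using \<tau>[of \<sigma> s] \<open>0 < \<mu>\<close> by (simp add: \<tau>_def divide_strict_right_mono)
    with elim have "w (\<sigma>, \<tau> \<sigma>) \<le> w (s, \<tau> s) + L * (\<tau> \<sigma> - \<tau> s)"
      using \<tau>[of \<sigma> s] \<tau>_in[of s] \<tau>_in[of \<sigma>] s assms
      by (intro arc_subsolution_interior_transport[OF sub cont h]) auto
    then show ?case
      by (simp add: \<tau>)
  qed
  then have "w (1, \<tau> 1) \<le> w (s, \<tau> s) + L * ((1 - s) / \<mu>)"
    by (rule tendsto_le[OF trivial_limit_at_left_real limR lim])
  then show ?thesis
    by (simp add: \<tau>_def)
qed simp

text \<open>
  A subgradient of \<open>h (1, \<cdot>)\<close> need not support \<open>h (s, \<cdot>)\<close> for \<open>s\<close> near \<open>1\<close> at large \<open>p\<close>, since \<open>h\<close>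
  may grow only linearly; its slope is therefore decreased slightly.
\<close>

lemma supporting_line_near_endpoint:
  fixes h :: "real \<times> real \<Rightarrow> real"
  assumes cont: "continuous_on ({0..1} \<times> UNIV) h"
    and conv: "\<And>s. s \<in> {0..1} \<Longrightarrow> convex_on UNIV (\<lambda>p. h (s, p))"
    and coer: "\<And>k. \<exists>R. \<forall>s\<in>{0..1}. \<forall>p. R \<le> \<bar>p\<bar> \<longrightarrow> k \<le> h (s, p)"
    and "a < b" and p0: "h (1, p0) < (a + b) / 2"
  obtains p1 \<mu> r where "0 < \<mu>" "0 < r" "r < 1" "h (1, p1) < b"
    "\<And>s p. s \<in> {1 - r..1} \<Longrightarrow> a + \<mu> * (p - p1) \<le> h (s, p)"
proof -
  \<comment> \<open>With \<open>p1\<close> placed at level \<open>a + 2 * e\<close>, the margin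
    \<open>2 * e\<close> above \<open>a\<close> absorbs the tilt of the line and the variation of
    \<open>h\<close> in \<open>s\<close>, at most \<open>e\<close> each.\<close>
  define e where "e = (b - a) / 4"
  have e: "0 < e" "(a + b) / 2 = a + 2 * e" "b = a + 4 * e"
    using \<open>a < b\<close> by (auto simp: e_def field_simps)
  obtain R where R: "\<And>s p. s \<in> {0..1} \<Longrightarrow> R \<le> \<bar>p\<bar> \<Longrightarrow> b \<le> h (s, p)"
    using coer[of b] by blast
  have "\<not> R \<le> \<bar>p0\<bar>"
    using R[of 1 p0] p0 e by auto
  then have p0R: "- R < p0" "p0 < R" by auto
  have cont1: "continuous_on S (\<lambda>p. h (1, p))" for S
    by (rule continuous_on_compose2[OF cont]) (auto intro!: continuous_intros)
  \<comment> \<open>\<open>p1\<close> lies to the right of \<open>p0\<close> at a higher value, so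
    every subgradient at \<open>p1\<close> is positive.\<close>
  have "\<exists>p. p0 \<le> p \<and> p \<le> R \<and> h (1, p) = a + 2 * e"
    using p0 p0R e R[of 1 R] cont1 by (intro IVT') auto
  then obtain p1 where p1: "p0 \<le> p1" "p1 \<le> R" "h (1, p1) = a + 2 * e"
    by blast
  have p1R: "p0 < p1" "p1 < R"
    using p1 p0 e R[of 1 R] p0R by (force simp: less_le)+
  obtain \<nu> where \<nu>: "\<And>p. h (1, p1) + \<nu> * (p - p1) \<le> h (1, p)"
    using convex_le_Inf_differential[OF conv[of 1], of p1] by fastforce
  have "0 < \<nu> * (p1 - p0)"
    using \<nu>[of p0] p0 p1(3) e by (simp add: algebra_simps)
  then have "0 < \<nu>"
    using p1R by (simp add: zero_less_mult_iff)
  \<comment> \<open>The bound \<open>\<nu> / 2\<close> keeps the reduced slope positive; the bound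
    \<open>e / (p1 + R)\<close> makes the tilt about \<open>p1\<close> cost at most \<open>e\<close>
    on \<open>{-R..p1}\<close>.\<close>
  define \<theta> where "\<theta> = min (\<nu> / 2) (e / (p1 + R))"
  have \<theta>: "0 < \<theta>" "\<theta> < \<nu>" "\<theta> * (p1 + R) \<le> e"
  proof -
    show "0 < \<theta>" "\<theta> < \<nu>"
      using \<open>0 < \<nu>\<close> e p0R p1R by (auto simp: \<theta>_def min_less_iff_disj)
    have "\<theta> * (p1 + R) \<le> e / (p1 + R) * (p1 + R)"
      using p0R p1R by (intro mult_right_mono) (auto simp: \<theta>_def)
    then show "\<theta> * (p1 + R) \<le> e"
      using p0R p1R by simp
  qed
  \<comment> \<open>\<open>2 * \<delta> \<le> \<theta>\<close> ensures that the increment over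
    \<open>{p1..p1 + 1}\<close> loses at most \<open>\<theta>\<close> when 1 is replaced by a nearby
    \<open>s\<close>.\<close>
  define \<delta> where "\<delta> = min e (\<theta> / 2)"
  have \<delta>: "0 < \<delta>" "\<delta> \<le> e" "2 * \<delta> \<le> \<theta>"
    using e \<theta> by (auto simp: \<delta>_def)
  have "uniformly_continuous_on ({0..1} \<times> {-R..p1 + 1}) h"
    by (intro compact_uniformly_continuous continuous_on_subset[OF cont] compact_Times) auto
  then obtain r where r: "0 < r" "\<And>z z'. z \<in> {0..1} \<times> {-R..p1 + 1} \<Longrightarrow> z' \<in> {0..1} \<times> {-R..p1 + 1} \<Longrightarrow>
      dist z' z < r \<Longrightarrow> dist (h z') (h z) < \<delta>"
    unfolding uniformly_continuous_on_def using \<delta>(1) by meson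
  define r' where "r' = min (r / 2) (1 / 2)"
  have r': "0 < r'" "r' < 1" "r' < r"
    using r(1) by (auto simp: r'_def)
  have near: "\<bar>h (s, p) - h (1, p)\<bar> < \<delta>" if "s \<in> {1 - r'..1}" "p \<in> {-R..p1 + 1}" for s p
    using r(2)[of "(1, p)" "(s, p)"] that r' by (auto simp: dist_Pair_Pair dist_real_def)
  show thesis
  proof
    show "0 < \<nu> - \<theta>" "0 < r'" "r' < 1"
      using \<theta> r' by auto
    show "h (1, p1) < b"
      using p1 e by simp
    fix s p assume s: "s \<in> {1 - r'..1}"
    then have s01: "s \<in> {0..1}"
      using r' by auto
    \<comment> \<open>Left of \<open>- R\<close> the line is below \<open>a\<close> and coercivity
      suffices. On the bounded range \<open>h (s, p)\<close> is close to \<open>h (1, p)\<close>.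
      Right of \<open>p1 + 1\<close> convexity propagates the chord slope over
      \<open>{p1..p1 + 1}\<close>.\<close>
    consider "p < - R" | "- R \<le> p" "p \<le> p1" | "p1 < p" "p \<le> p1 + 1" | "p1 + 1 < p"
      by linarith
    then show "a + (\<nu> - \<theta>) * (p - p1) \<le> h (s, p)"
    proof cases
      case 1
      then have "(\<nu> - \<theta>) * (p - p1) \<le> 0"
        using \<theta> p0R p1R by (intro mult_nonneg_nonpos) auto
      then show ?thesis
        using R[OF s01, of p] 1 e p0R by auto
    next
      case 2
      have "\<theta> * (p1 - p) \<le> \<theta> * (p1 + R)"
        using \<theta> 2 by (intro mult_left_mono) auto
      then show ?thesis
        using \<nu>[of p] p1(3) near[OF s, of p] 2 \<theta> \<delta> p1R by (simp add: algebra_simps)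
    next
      case 3
      have "0 \<le> \<theta> * (p - p1)"
        using \<theta> 3 by simp
      moreover have "(\<nu> - \<theta>) * (p - p1) = \<nu> * (p - p1) - \<theta> * (p - p1)"
        by (simp add: algebra_simps)
      moreover have "\<bar>h (s, p) - h (1, p)\<bar> < \<delta>"
        using 3 p0R p1R by (intro near[OF s]) auto
      ultimately show ?thesis
        using \<nu>[of p] p1(3) \<delta> e by linarith
    next
      case 4
      define \<rho> where "\<rho> = 1 / (p - p1)"
      have l: "0 \<le> \<rho>" "\<rho> \<le> 1" "\<rho> * (p - p1) = 1"
        using 4 by (auto simp: \<rho>_def)
      have "p1 + 1 = (1 - \<rho>) * p1 + \<rho> * p"
        using l(3) by (simp add: algebra_simps)
      then have "h (s, p1 + 1) \<le> (1 - \<rho>) * h (s, p1) + \<rho> * h (s, p)"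
        using convex_onD[OF conv[OF s01] l(1,2), of p1 p] by simp
      then have "(h (s, p1 + 1) - h (s, p1)) * (p - p1) \<le> (\<rho> * (h (s, p) - h (s, p1))) * (p - p1)"
        using 4 by (intro mult_right_mono) (auto simp: algebra_simps)
      also have "\<dots> = (\<rho> * (p - p1)) * (h (s, p) - h (s, p1))"
        by (simp only: mult_ac)
      also have "\<dots> = h (s, p) - h (s, p1)"
        using l(3) by simp
      finally have "(h (s, p1 + 1) - h (s, p1)) * (p - p1) \<le> h (s, p) - h (s, p1)" .
      moreover have "\<nu> - \<theta> \<le> h (s, p1 + 1) - h (s, p1)"
        using \<nu>[of "p1 + 1"] near[OF s, of p1] near[OF s, of "p1 + 1"] \<delta> p0R p1R by simp
      then have "(\<nu> - \<theta>) * (p - p1) \<le> (h (s, p1 + 1) - h (s, p1)) * (p - p1)"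
        using 4 by (intro mult_right_mono) auto
      ultimately show ?thesis
        using near[OF s, of p1] \<delta> e p0R p1R p1(3) by simp
    qed
  qed
qed

section \<open>Comparison on an arc\<close>

text \<open>With \<open>s\<close> doubled as well, subtracting the two viscosity inequalities at an
  interior maximizer leaves \<open>\<alpha> \<le> h (s', p) - h (s, p)\<close>. Since
  \<open>p\<close> is bounded and \<open>s'\<close> is close to \<open>s\<close>, this contradicts
  the uniform continuity of \<open>h\<close>.\<close>

lemma arc_maximum_on_boundary:
  assumes sub: "arc_subsolution h T0 T1 w" and super: "arc_supersolution h' T0 T1 v"
    and T: "T0 < T" "ereal T < T1"
    and contw: "continuous_on ({0..1} \<times> {T0..T}) w"
    and contv: "continuous_on ({0..1} \<times> {T0..T}) v"
    and conth: "continuous_on ({0..1} \<times> UNIV) h"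
    and coer: "\<And>k. \<exists>R. \<forall>s\<in>{0..1}. \<forall>p. R \<le> \<bar>p\<bar> \<longrightarrow> k \<le> h (s, p)"
    and le: "\<And>s p. s \<in> {0..1} \<Longrightarrow> h' (s, p) \<le> h (s, p) + \<kappa>"
    and P: "\<And>t. (P has_real_derivative P' t) (at t)" "continuous_on UNIV P'"
    and P': "\<And>t. t \<in> {T0..T} \<Longrightarrow> \<kappa> + \<alpha> \<le> P' t" and "0 < \<alpha>" and "0 \<le> K"
    and z0: "s0 \<in> {0..1}" "t0 \<in> {T0..T}" "t0' \<in> {T0..T}"
    and M: "M \<le> w (s0, t0) - v (s0, t0') - P t0 - K * (t0 - t0')^2"
    and bdry: "\<And>s t t'. s \<in> {0..1} \<Longrightarrow> t \<in> {T0..T} \<Longrightarrow> t' \<in> {T0..T} \<Longrightarrow>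
      s \<notin> {0<..<1} \<or> t \<notin> {T0<..<T} \<or> t' \<notin> {T0<..<T} \<Longrightarrow>
      w (s, t) - v (s, t') - P t - K * (t - t')^2 < M"
  shows False
proof -
  \<comment> \<open>The time coupling has slope at most \<open>2 * K * (T - T0)\<close> in absolute
    value, so the subsolution inequality will force \<open>h (s, p)\<close> below this level. Thus
    \<open>R\<close>, and with it \<open>\<omega>\<close>, is fixed before the penalty
    \<open>n\<close>.\<close>
  obtain R where R: "\<And>s p. s \<in> {0..1} \<Longrightarrow> R \<le> \<bar>p\<bar> \<Longrightarrow> 2 * K * (T - T0) - \<kappa> \<le> h (s, p)"
    using coer[of "2 * K * (T - T0) - \<kappa>"] by blast
  have "uniformly_continuous_on ({0..1} \<times> {-R..R}) h"
    by (intro compact_uniformly_continuous continuous_on_subset[OF conth] compact_Times) auto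
  then obtain \<omega> where \<omega>: "0 < \<omega>" "\<And>z z'. z \<in> {0..1} \<times> {-R..R} \<Longrightarrow> z' \<in> {0..1} \<times> {-R..R} \<Longrightarrow>
      dist z' z < \<omega> \<Longrightarrow> dist (h z') (h z) < \<alpha>"
    unfolding uniformly_continuous_on_def using \<open>0 < \<alpha>\<close> by meson
  define B :: "((real \<times> real) \<times> (real \<times> real)) set" where "B = ({0..1} \<times> {0..1}) \<times> ({T0..T} \<times> {T0..T})"
  define N :: "((real \<times> real) \<times> (real \<times> real)) set"
    where "N = ({0<..<1} \<times> {0<..<1}) \<times> ({T0<..<T} \<times> {T0<..<T})"
  define F where "F z = w (fst (fst z), fst (snd z)) - v (snd (fst z), snd (snd z)) - P (fst (snd z))
    - K * (fst (snd z) - snd (snd z))^2" for z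
  define d :: "(real \<times> real) \<times> (real \<times> real) \<Rightarrow> real" where "d z = (fst (fst z) - snd (fst z))^2" for z
  have contP: "continuous_on UNIV P"
    using P(1) by (meson DERIV_isCont continuous_at_imp_continuous_on)
  have B: "compact B" "open N" "N \<subseteq> B"
    by (auto simp: B_def N_def intro!: compact_Times open_Times)
  have contF: "continuous_on B F"
    unfolding F_def
    by (intro continuous_intros continuous_on_compose2[OF contw] continuous_on_compose2[OF contv]
        continuous_on_compose2[OF contP]) (auto simp: B_def)
  have contd: "continuous_on B d"
    unfolding d_def by (intro continuous_intros)
  \<comment> \<open>Including the points with \<open>\<omega> \<le> \<bar>s - s'\<bar>\<close> lets
    one choice of \<open>n\<close> keep maximizers both in the interior and near the diagonal in
    space.\<close>
  define Bd where "Bd = (B - N) \<union> (B \<inter> {z. \<omega>^2 \<le> d z})"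
  have "compact (B \<inter> {z. \<omega>^2 \<le> d z})"
    unfolding d_def by (intro compact_Int_closed B closed_Collect_le continuous_intros)
  then have Bd: "compact Bd" "Bd \<subseteq> B"
    using B by (auto simp: Bd_def intro!: compact_Un compact_diff)
  have less: "F z < M" if "z \<in> Bd" "d z = 0" for z
  proof -
    obtain s s' t t' where z: "z = ((s, s'), (t, t'))" by (metis surj_pair)
    have "s' = s"
      using that z by (simp add: d_def)
    moreover have "z \<in> B" "z \<notin> N"
      using that \<omega>(1) by (auto simp: Bd_def)
    ultimately show ?thesis
      using bdry[of s t t'] by (auto simp: F_def z B_def N_def)
  qed
  have "0 \<le> d z" for z
    by (simp add: d_def)
  then obtain n where n: "\<And>z. z \<in> Bd \<Longrightarrow> F z - n * d z < M"
    using penalization[OF Bd(1) continuous_on_subset[OF contF Bd(2)] continuous_on_subset[OF contd Bd(2)] _ less]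
    by blast
  have z0B: "((s0, s0), (t0, t0')) \<in> B"
    using z0 by (simp add: B_def)
  have "continuous_on B (\<lambda>z. F z - n * d z)"
    by (intro continuous_intros contF contd)
  then obtain z where z: "z \<in> B" "\<And>z'. z' \<in> B \<Longrightarrow> F z' - n * d z' \<le> F z - n * d z"
    using continuous_attains_sup[OF B(1)] z0B by blast
  have "M \<le> F z - n * d z"
    using z(2)[OF z0B] M by (simp add: F_def d_def)
  then have "z \<notin> Bd"
    using n[of z] by auto
  then have zN: "z \<in> N" "d z < \<omega>^2"
    using z(1) by (auto simp: Bd_def)
  obtain s s' t t' where zeq: "z = ((s, s'), (t, t'))" by (metis surj_pair)
  have st: "0 < s" "s < 1" "0 < s'" "s' < 1" "T0 < t" "t < T" "T0 < t'" "t' < T"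
    using zN zeq by (auto simp: N_def)
  have topen: "t \<in> open_time_interval T0 T1" "t' \<in> open_time_interval T0 T1"
    using st T less_trans[of "ereal _" "ereal T" T1] by (auto simp: open_time_interval_def)
  \<comment> \<open>The coupling terms have opposite derivatives in the two copies and
    \<open>v\<close> enters with a minus sign, so both test functions share the slopes
    \<open>q\<close> (up to \<open>P'\<close>) and \<open>p\<close>.\<close>
  define q where "q = 2 * K * (t - t')"
  define p where "p = 2 * n * (s - s')"
  define \<phi> where "\<phi> z = (P (snd z) + K * (snd z - t')^2) + n * (fst z - s')^2" for z :: "real \<times> real"
  define \<psi> where "\<psi> z = - K * (t - snd z)^2 + - n * (s - fst z)^2" for z :: "real \<times> real"
  have C1: "C1_fun \<phi>"
    unfolding \<phi>_def
  proof (intro C1_fun_add)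
    show "C1_fun (\<lambda>z::real\<times>real. P (snd z))"
      by (rule C1_fun_compose_linear[OF bounded_linear_snd P])
    show "C1_fun (\<lambda>z::real\<times>real. K * (snd z - t')^2)"
      by (rule C1_fun_compose_linear[OF bounded_linear_snd, of "\<lambda>x. K * (x - t')^2" "\<lambda>x. K * (2 * (x - t'))"])
        (auto intro!: derivative_eq_intros continuous_intros simp: algebra_simps)
    show "C1_fun (\<lambda>z::real\<times>real. n * (fst z - s')^2)"
      by (rule C1_fun_compose_linear[OF bounded_linear_fst, of "\<lambda>x. n * (x - s')^2" "\<lambda>x. n * (2 * (x - s'))"])
        (auto intro!: derivative_eq_intros continuous_intros simp: algebra_simps)
  qed
  have C1': "C1_fun \<psi>"
    unfolding \<psi>_def
  proof (intro C1_fun_add)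
    show "C1_fun (\<lambda>z::real\<times>real. - K * (t - snd z)^2)"
      by (rule C1_fun_compose_linear[OF bounded_linear_snd, of "\<lambda>x. - K * (t - x)^2" "\<lambda>x. K * (2 * (t - x))"])
        (auto intro!: derivative_eq_intros continuous_intros simp: algebra_simps)
    show "C1_fun (\<lambda>z::real\<times>real. - n * (s - fst z)^2)"
      by (rule C1_fun_compose_linear[OF bounded_linear_fst, of "\<lambda>x. - n * (s - x)^2" "\<lambda>x. n * (2 * (s - x))"])
        (auto intro!: derivative_eq_intros continuous_intros simp: algebra_simps)
  qed
  have "supertangent ({0<..<1} \<times> open_time_interval T0 T1) w (s, t) \<phi>"
  proof (rule supertangentI[OF C1])
    show "open ({0<..<1::real} \<times> {T0<..<T})"
      by (intro open_Times) auto
    show "(s, t) \<in> {0<..<1} \<times> {T0<..<T}"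
      using st by auto
    fix y :: "real \<times> real" assume "y \<in> {0<..<1} \<times> {T0<..<T}"
    then have "((fst y, s'), (snd y, t')) \<in> B"
      using st by (auto simp: B_def)
    from z(2)[OF this] show "w y - \<phi> y \<le> w (s, t) - \<phi> (s, t)"
      by (simp add: zeq F_def d_def \<phi>_def)
  qed
  then have "hj_operator h \<phi> s t \<le> 0"
    using sub st topen by (auto simp: arc_subsolution_def)
  moreover have "hj_operator h \<phi> s t = (P' t + q) + h (s, p)"
    unfolding \<phi>_def p_def q_def
    by (rule hj_operator_eq) (auto intro!: derivative_eq_intros P(1))
  ultimately have 1: "P' t + q + h (s, p) \<le> 0" by simp
  have "subtangent ({0<..<1} \<times> open_time_interval T0 T1) v (s', t') \<psi>"
  proof (rule subtangentI[OF C1'])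
    show "open ({0<..<1::real} \<times> {T0<..<T})"
      by (intro open_Times) auto
    show "(s', t') \<in> {0<..<1} \<times> {T0<..<T}"
      using st by auto
    fix y :: "real \<times> real" assume "y \<in> {0<..<1} \<times> {T0<..<T}"
    then have "((s, fst y), (t, snd y)) \<in> B"
      using st by (auto simp: B_def)
    from z(2)[OF this] show "v (s', t') - \<psi> (s', t') \<le> v y - \<psi> y"
      by (simp add: zeq F_def d_def \<psi>_def)
  qed
  then have "0 \<le> hj_operator h' \<psi> s' t'"
    using super st topen by (auto simp: arc_supersolution_def)
  moreover have "hj_operator h' \<psi> s' t' = q + h' (s', p)"
    unfolding \<psi>_def p_def q_def
    by (rule hj_operator_eq) (auto intro!: derivative_eq_intros simp: algebra_simps)
  ultimately have 2: "0 \<le> q + h (s', p) + \<kappa>"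
    using le[of s' p] st by simp
  have "K * (t' - t) \<le> K * (T - T0)"
    using st \<open>0 \<le> K\<close> by (intro mult_left_mono) auto
  then have "h (s, p) < 2 * K * (T - T0) - \<kappa>"
    using 1 P'[of t] st \<open>0 < \<alpha>\<close> by (simp add: q_def algebra_simps)
  then have "\<not> R \<le> \<bar>p\<bar>"
    using R[of s p] st by auto
  then have "- R \<le> p" "p \<le> R" by auto
  moreover have "\<bar>s - s'\<bar> < \<omega>"
    using zN(2) zeq \<omega>(1) abs_le_square_iff[of \<omega> "s - s'"] by (simp add: d_def not_le[symmetric])
  ultimately have "\<bar>h (s', p) - h (s, p)\<bar> < \<alpha>"
    using \<omega>(2)[of "(s, p)" "(s', p)"] st by (auto simp: dist_Pair_Pair dist_real_def abs_minus_commute)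
  then show False
    using 1 2 P'[of t] st by auto
qed

section \<open>Arc constants and the network\<close>

text \<open>Coercivity and compactness bound \<open>H \<gamma> (s, p)\<close> below, and its values
  at \<open>p = 0\<close> bound the infima above, so \<open>SUP\<close> and \<open>INF\<close> can
  be unfolded. The form with \<open>e\<close> passes to limits of Hamiltonians.\<close>

lemma (in hamiltonians) le_arc_constant_iff:
  assumes "\<gamma> \<in> E"
  shows "d \<le> arc_constant H \<gamma> \<longleftrightarrow> (\<forall>s\<in>{0..1}. \<forall>e>0. \<exists>p. H \<gamma> (s, p) < - d + e)"
proof -
  obtain R where R: "\<And>s p. s \<in> {0..1} \<Longrightarrow> R \<le> \<bar>p\<bar> \<Longrightarrow> 0 \<le> H \<gamma> (s, p)"
    using coercive[OF assms, of 0] by blast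
  have "continuous_on ({0..1} \<times> {- R..R}) (H \<gamma>)"
    using continuous[OF assms] by (rule continuous_on_subset) auto
  then have "compact (H \<gamma> ` ({0..1} \<times> {- R..R}))"
    by (intro compact_continuous_image compact_Times) auto
  then obtain m where m: "\<And>s p. s \<in> {0..1} \<Longrightarrow> \<bar>p\<bar> \<le> R \<Longrightarrow> m \<le> H \<gamma> (s, p)"
    using bounded_imp_bdd_below[OF compact_imp_bounded] by (force simp: bdd_below_def)
  have below: "bdd_below (range (\<lambda>p. H \<gamma> (s, p)))" if "s \<in> {0..1}" for s
    using R[OF that] m[OF that] by (intro bdd_belowI2[of _ "min 0 m"]) (metis linear min.coboundedI1 min.coboundedI2)
  have "continuous_on {0..1} (\<lambda>s. H \<gamma> (s, 0))"
    by (rule continuous_on_compose2[OF continuous[OF assms]]) (auto intro!: continuous_intros)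
  then have "bdd_above ((\<lambda>s. H \<gamma> (s, 0)) ` {0..1})"
    by (intro bounded_imp_bdd_above compact_imp_bounded compact_continuous_image) auto
  then obtain C where C: "\<And>s. s \<in> {0..1} \<Longrightarrow> H \<gamma> (s, 0) \<le> C"
    by (force simp: bdd_above_def)
  have above: "bdd_above ((\<lambda>s. INF p. H \<gamma> (s, p)) ` {0..1})"
  proof (rule bdd_aboveI2)
    fix s :: real assume s: "s \<in> {0..1}"
    show "(INF p. H \<gamma> (s, p)) \<le> C"
      by (rule cINF_lower2[OF below[OF s], of 0]) (auto simp: C[OF s])
  qed
  have "d \<le> arc_constant H \<gamma> \<longleftrightarrow> (SUP s\<in>{0..1}. INF p. H \<gamma> (s, p)) \<le> - d"
    by (auto simp: arc_constant_def)
  also have "\<dots> \<longleftrightarrow> (\<forall>s\<in>{0..1}. (INF p. H \<gamma> (s, p)) \<le> - d)"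
    by (rule cSUP_le_iff[OF _ above]) simp
  also have "\<dots> \<longleftrightarrow> (\<forall>s\<in>{0..1}. \<forall>e>0. \<exists>p. H \<gamma> (s, p) < - d + e)"
  proof (intro ball_cong refl)
    fix s :: real assume s: "s \<in> {0..1}"
    have "(INF p. H \<gamma> (s, p)) \<le> - d \<longleftrightarrow> (\<forall>e>0. (INF p. H \<gamma> (s, p)) < - d + e)"
      using field_le_epsilon[of "INF p. H \<gamma> (s, p)" "- d"] by (force intro: less_imp_le)
    also have "\<dots> \<longleftrightarrow> (\<forall>e>0. \<exists>p. H \<gamma> (s, p) < - d + e)"
      using cINF_less_iff[OF _ below[OF s]] by simp
    finally show "(INF p. H \<gamma> (s, p)) \<le> - d \<longleftrightarrow> (\<forall>e>0. \<exists>p. H \<gamma> (s, p) < - d + e)" .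
  qed
  finally show ?thesis .
qed

lemma (in network) compact_support: "compact (support E)"
  unfolding support_def
  by (intro compact_UN finite_arcs compact_path_image simple_path_imp_path simple)

lemma (in network) arc_in_support: "\<gamma> \<in> E \<Longrightarrow> s \<in> {0..1} \<Longrightarrow> \<gamma> s \<in> support E"
  unfolding support_def path_image_def by blast

lemma (in network) endpoints_in_vertices: "\<gamma> \<in> E \<Longrightarrow> \<gamma> 0 \<in> vertices E \<and> \<gamma> 1 \<in> vertices E"
  by (auto simp: vertices_def pathstart_def pathfinish_def)

lemma (in network) finite_vertices: "finite (vertices E)"
  using finite_arcs by (simp add: vertices_def)

lemma (in network) finite_arcs_into: "finite (arcs_into E x)"
  using finite_arcs by (simp add: arcs_into_def)

text \<open>An arc starting at \<open>x\<close> ends there after reversal; hence the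
  \<open>MIN\<close> in \<open>flux_limiter\<close> is over a nonempty set.\<close>

lemma (in network) arcs_into_nonempty:
  assumes "x \<in> vertices E"
  shows "arcs_into E x \<noteq> {}"
  using assms inverse_arc by (force simp: vertices_def arcs_into_def)

lemma (in network) flux_limiter_iff:
  "flux_limiter E H c \<longleftrightarrow> (\<forall>x\<in>vertices E. \<forall>\<gamma>\<in>arcs_into E x. c x \<le> arc_constant H \<gamma>)"
  unfolding flux_limiter_def using finite_arcs_into arcs_into_nonempty by (simp cong: ball_cong)

lemma (in network) continuous_along:
  assumes "continuous_on (support E \<times> I) v" "\<gamma> \<in> E"
  shows "continuous_on ({0..1} \<times> I) (along v \<gamma>)"
proof -
  have "continuous_on {0..1} \<gamma>"
    using simple_path_imp_path[OF simple[OF assms(2)]] by (simp add: path_def)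
  then have "continuous_on ({0..1} \<times> I) (\<lambda>z. \<gamma> (fst z))"
    by (rule continuous_on_compose2) (auto intro!: continuous_intros)
  then have "continuous_on ({0..1} \<times> I) (\<lambda>z. v (\<gamma> (fst z), snd z))"
    by (intro continuous_on_compose2[OF assms(1)] continuous_intros)
      (auto simp: arc_in_support[OF assms(2)])
  then show ?thesis
    by (simp add: along_def case_prod_beta')
qed

section \<open>Comparison on the network\<close>

text \<open>
  With \<open>q = 2 K (t0 - t0')\<close> the subsolution condition gives \<open>P' t0 + q \<le> c x\<close>, hence \<open>q < c' x\<close>,
  and the supersolution condition selects an arc. The transport estimate of \<open>u\<close> along that arc,
  inserted into the maximality of \<open>(x, t0, t0')\<close> with \<open>t = t0 - (1 - s) / \<mu>\<close>, bounds \<open>v\<close> from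
  below by an explicit function whose slope \<open>p1\<close> in \<open>s\<close> satisfies \<open>q + H' \<gamma> (1, p1) < 0\<close>.
\<close>

lemma vertex_not_maximum:
  fixes E :: "(real \<Rightarrow> 'a::euclidean_space) set"
  assumes "network E" and ham: "hamiltonians E H" and flux: "flux_limiter E H c"
    and sub: "hj_subsolution E H c T0 T1 u" and super: "hj_supersolution E H' c' T0 T1 v"
    and T: "ereal T < T1"
    and H_le: "\<And>\<gamma> s p. \<gamma> \<in> E \<Longrightarrow> s \<in> {0..1} \<Longrightarrow> H' \<gamma> (s, p) \<le> H \<gamma> (s, p) + \<kappa>"
    and c_le: "\<And>x. x \<in> vertices E \<Longrightarrow> c x \<le> c' x + \<kappa>"
    and P: "\<And>t. (P has_real_derivative P' t) (at t)" "continuous_on UNIV P'"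
    and x: "x \<in> vertices E" and t0: "t0 \<in> {T0<..<T}" and t0': "t0' \<in> {T0<..<T}"
    and P': "\<kappa> < P' t0"
    and max: "\<And>y t t'. y \<in> support E \<Longrightarrow> t \<in> {T0..T} \<Longrightarrow> t' \<in> {T0..T} \<Longrightarrow>
      u (y, t) - v (y, t') - P t - K * (t - t')^2 \<le> u (x, t0) - v (x, t0') - P t0 - K * (t0 - t0')^2"
  shows False
proof -
  interpret network E by fact
  interpret hamiltonians E H by fact
  define q where "q = 2 * K * (t0 - t0')"
  have t_open: "t0 \<in> open_time_interval T0 T1" "t0' \<in> open_time_interval T0 T1"
    using t0 t0' T less_trans[of "ereal _" "ereal T" T1] by (auto simp: open_time_interval_def)
  have xs: "x \<in> support E"
    using x by (auto simp: vertices_def support_def)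
  \<comment> \<open>Freezing the point \<open>x\<close> and one of the two times in
    \<open>max\<close> gives a test function for \<open>u\<close> here and one for \<open>v\<close>
    below.\<close>
  have "supertangent (open_time_interval T0 T1) (\<lambda>\<tau>. u (x, \<tau>)) t0 (\<lambda>t. P t + K * (t - t0')^2)"
  proof (rule supertangentI[of _ "{T0<..<T}"])
    show "C1_fun (\<lambda>t. P t + K * (t - t0')^2)"
      by (rule C1_fun_compose_linear[OF bounded_linear_ident, of _ "\<lambda>t. P' t + K * (2 * (t - t0'))"])
        (auto intro!: derivative_eq_intros continuous_intros P)
    show "u (x, t) - (P t + K * (t - t0')^2) \<le> u (x, t0) - (P t0 + K * (t0 - t0')^2)"
      if "t \<in> {T0<..<T}" for t
      using max[OF xs, of t t0'] that t0' by simp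
  qed (use t0 in auto)
  moreover have "deriv (\<lambda>t. P t + K * (t - t0')^2) t0 = P' t0 + q"
    by (rule DERIV_imp_deriv) (auto simp: q_def intro!: derivative_eq_intros P)
  ultimately have qc: "P' t0 + q \<le> c x"
    using sub x t_open unfolding hj_subsolution_def by metis
  have "subtangent (open_time_interval T0 T1) (\<lambda>\<tau>. v (x, \<tau>)) t0' (\<lambda>t. - K * (t0 - t)^2)"
  proof (rule subtangentI[of _ "{T0<..<T}"])
    show "C1_fun (\<lambda>t. - K * (t0 - t)^2)"
      by (rule C1_fun_compose_linear[OF bounded_linear_ident, of _ "\<lambda>t. K * (2 * (t0 - t))"])
        (auto intro!: derivative_eq_intros continuous_intros simp: algebra_simps)
    show "v (x, t0') - - K * (t0 - t0')^2 \<le> v (x, t) - - K * (t0 - t)^2"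
      if "t \<in> {T0<..<T}" for t
      using max[OF xs, of t0 t] that t0 by simp
  qed (use t0' in auto)
  moreover have "deriv (\<lambda>t. - K * (t0 - t)^2) t0' = q"
    by (rule DERIV_imp_deriv) (auto simp: q_def algebra_simps intro!: derivative_eq_intros)
  moreover have "q < c' x"
    using qc c_le[OF x] P' by simp
  ultimately have "\<exists>\<phi>. subtangent (open_time_interval T0 T1) (\<lambda>\<tau>. v (x, \<tau>)) t0' \<phi> \<and> deriv \<phi> t0' < c' x"
    by auto
  then obtain \<gamma> where \<gamma>: "\<gamma> \<in> arcs_into E x" and all: "\<And>\<phi>.
      subtangent ({0..1} \<times> closure (open_time_interval T0 T1)) (along v \<gamma>) (1, t0') \<phi> \<Longrightarrow>
      0 \<le> hj_operator (H' \<gamma>) \<phi> 1 t0'"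
    using super x t_open(2) unfolding hj_supersolution_def by blast
  have \<gamma>E: "\<gamma> \<in> E" and \<gamma>1: "\<gamma> 1 = x"
    using \<gamma> by (auto simp: arcs_into_def pathfinish_def)
  \<comment> \<open>\<open>- c x \<le> a\<close>, so \<open>H \<gamma> (1, p)\<close> takes values
    below any level above \<open>a\<close>; below the level \<open>b\<close>,
    \<open>q + H' \<gamma> (1, p)\<close> is negative. The gap is
    \<open>P' t0 - \<kappa>\<close>.\<close>
  define a where "a = - q - P' t0"
  define b where "b = - q - \<kappa>"
  have ab: "a < b"
    using P' by (simp add: a_def b_def)
  have "c x \<le> arc_constant H \<gamma>"
    using flux \<gamma> x by (auto simp: flux_limiter_iff)
  then obtain p0 where "H \<gamma> (1, p0) < - c x + (b - a) / 2"
    using ab unfolding le_arc_constant_iff[OF \<gamma>E] by force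
  also have "- c x + (b - a) / 2 \<le> (a + b) / 2"
    using qc by (simp add: a_def field_simps)
  finally have p0: "H \<gamma> (1, p0) < (a + b) / 2" .
  obtain \<mu> r p1 where pr: "0 < \<mu>" "0 < r" "r < 1" "H \<gamma> (1, p1) < b"
    and line: "\<And>s p. s \<in> {1 - r..1} \<Longrightarrow> a + \<mu> * (p - p1) \<le> H \<gamma> (s, p)"
  proof (rule supporting_line_near_endpoint[OF continuous[OF \<gamma>E] _ coercive[OF \<gamma>E] ab p0])
    show "convex_on UNIV (\<lambda>p. H \<gamma> (s, p))" if "s \<in> {0..1}" for s
      by (rule convex[OF \<gamma>E that])
  qed (rule that)
  \<comment> \<open>Rewrites the supporting line as \<open>\<mu> * p - L\<close>, the form of the
    transport estimate.\<close>
  define L where "L = \<mu> * p1 - a"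
  define \<tau> where "\<tau> s = t0 - (1 - s) / \<mu>" for s
  have transport: "u (x, t0) \<le> u (\<gamma> s, \<tau> s) + L * (1 - s) / \<mu>"
    if "1 - r < s" "s \<le> 1" "T0 < \<tau> s" for s
  proof -
    have "along u \<gamma> (1, t0) \<le> along u \<gamma> (s, t0 - (1 - s) / \<mu>) + L * (1 - s) / \<mu>"
    proof (rule arc_subsolution_transport)
      show "arc_subsolution (H \<gamma>) T0 T1 (along u \<gamma>)"
        using sub \<gamma>E by (auto simp: hj_subsolution_def)
      show "continuous_on ({0..1} \<times> time_interval T0 T1) (along u \<gamma>)"
        using sub \<gamma>E by (auto simp: hj_subsolution_def intro!: continuous_along)
      show "\<mu> * p - L \<le> H \<gamma> (s, p)" if "s \<in> {1 - r..1}" for s p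
        using line[OF that, of p] by (simp add: L_def algebra_simps)
      show "ereal t0 < T1"
        using t_open by (simp add: open_time_interval_def)
    qed (use that pr in \<open>auto simp: \<tau>_def\<close>)
    then show ?thesis
      by (simp add: along_def \<gamma>1 \<tau>_def)
  qed
  \<comment> \<open>Split into a function of \<open>s\<close> and a function of the linear form
    \<open>s / \<mu> - t\<close>, to fit \<open>C1_fun_compose_linear\<close>.\<close>
  define \<phi> where "\<phi> z = (- ((1 - fst z) * L / \<mu>) - P (\<tau> (fst z)))
    + - K * ((fst z / \<mu> - snd z) + t0 - 1 / \<mu>)^2" for z
  have \<phi>: "\<phi> (s, t) = - (L * (1 - s) / \<mu>) - P (\<tau> s) - K * (\<tau> s - t)^2" for s t
    by (simp add: \<phi>_def \<tau>_def diff_divide_distrib algebra_simps)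
  have C1: "C1_fun \<phi>"
    unfolding \<phi>_def
  proof (intro C1_fun_add)
    have "((\<lambda>s. - ((1 - s) * L / \<mu>) - P (\<tau> s)) has_real_derivative L / \<mu> - P' (\<tau> s) * (1 / \<mu>)) (at s)" for s
      unfolding \<tau>_def using pr(1) by (auto intro!: derivative_eq_intros DERIV_chain2[OF P(1)])
    moreover have "continuous_on UNIV (\<lambda>s. L / \<mu> - P' (\<tau> s) * (1 / \<mu>))"
      unfolding \<tau>_def using pr(1) by (intro continuous_intros continuous_on_compose2[OF P(2)]) auto
    ultimately show "C1_fun (\<lambda>z::real\<times>real. - ((1 - fst z) * L / \<mu>) - P (\<tau> (fst z)))"
      by (rule C1_fun_compose_linear[OF bounded_linear_fst])
    have "bounded_linear (\<lambda>z::real\<times>real. fst z / \<mu> - snd z)"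
      by (intro bounded_linear_sub bounded_linear_compose[OF bounded_linear_divide bounded_linear_fst] bounded_linear_snd)
    then show "C1_fun (\<lambda>z::real\<times>real. - K * ((fst z / \<mu> - snd z) + t0 - 1 / \<mu>)^2)"
      by (rule C1_fun_compose_linear[of _ "\<lambda>y. - K * (y + t0 - 1 / \<mu>)^2" "\<lambda>y. - K * (2 * (y + t0 - 1 / \<mu>))"])
        (auto intro!: derivative_eq_intros continuous_intros)
  qed
  have "subtangent ({0..1} \<times> closure (open_time_interval T0 T1)) (along v \<gamma>) (1, t0') \<phi>"
  proof (rule subtangentI[OF C1])
    \<comment> \<open>\<open>S\<close> may pass beyond \<open>s = 1\<close>, as contact is
      constrained to \<open>{0..1}\<close>. Its lower bounds on \<open>s\<close> keep the supporting
      line valid and \<open>\<tau> s\<close> after \<open>T0\<close>.\<close>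
    define S where "S = {max (1 - r) (1 - \<mu> * (t0 - T0))<..} \<times> {T0<..<T}"
    show "open S"
      unfolding S_def by (intro open_Times) auto
    show "(1, t0') \<in> S"
      using t0 t0' pr by (auto simp: S_def)
    fix z assume z: "z \<in> S" "z \<in> {0..1} \<times> closure (open_time_interval T0 T1)"
    obtain s t where st: "z = (s, t)" by force
    have s: "1 - r < s" "1 - \<mu> * (t0 - T0) < s" "0 \<le> s" "s \<le> 1" and t: "T0 < t" "t < T"
      using z st by (auto simp: S_def)
    have \<tau>s: "T0 < \<tau> s" "\<tau> s \<le> t0"
      using s pr(1) by (auto simp: \<tau>_def field_simps)
    have "u (\<gamma> s, \<tau> s) - v (\<gamma> s, t) - P (\<tau> s) - K * (\<tau> s - t)^2
      \<le> u (x, t0) - v (x, t0') - P t0 - K * (t0 - t0')^2"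
      using \<tau>s t t0 s by (intro max arc_in_support[OF \<gamma>E]) auto
    then show "along v \<gamma> (1, t0') - \<phi> (1, t0') \<le> along v \<gamma> z - \<phi> z"
      using transport[OF s(1,4) \<tau>s(1)] by (simp add: st \<phi> along_def \<gamma>1) (simp add: \<tau>_def)
  qed
  then have "0 \<le> hj_operator (H' \<gamma>) \<phi> 1 t0'"
    by (rule all)
  moreover have "hj_operator (H' \<gamma>) \<phi> 1 t0' = q + H' \<gamma> (1, p1)"
  proof (rule hj_operator_eq)
    show "((\<lambda>t. \<phi> (1, t)) has_real_derivative q) (at t0')"
      unfolding \<phi> by (auto intro!: derivative_eq_intros simp: q_def \<tau>_def algebra_simps)
    have "((\<lambda>s. \<phi> (s, t0')) has_real_derivative
        L / \<mu> - P' t0 * (1 / \<mu>) - K * (2 * (t0 - t0') * (1 / \<mu>))) (at 1)"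
      unfolding \<phi> \<tau>_def using pr(1)
      by (auto intro!: derivative_eq_intros DERIV_chain2[OF P(1)])
    \<comment> \<open>The choice of \<open>a\<close> cancels the contributions of \<open>P\<close>
      and of the time coupling.\<close>
    moreover have "L / \<mu> - P' t0 * (1 / \<mu>) - K * (2 * (t0 - t0') * (1 / \<mu>)) = p1"
      using pr(1) by (simp add: L_def a_def q_def field_simps)
    ultimately show "((\<lambda>s. \<phi> (s, t0')) has_real_derivative p1) (at 1)"
      by simp
  qed
  ultimately show False
    using pr(4) H_le[OF \<gamma>E, of 1 p1] by (simp add: b_def)
qed

text \<open>If the bound failed at \<open>(x, t)\<close>, adding a barrier to it would give a
  \<open>P\<close> for which the time-doubled maximum is positive and stays off the times
  \<open>T0\<close> and \<open>T\<close>. \<open>vertex_not_maximum\<close> moves it off the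
  vertices, and \<open>arc_maximum_on_boundary\<close> excludes it inside an arc.\<close>

theorem continuous_dependence:
  fixes E :: "(real \<Rightarrow> 'a::euclidean_space) set"
  assumes net: "network E" and ham: "hamiltonians E H" and flux: "flux_limiter E H c"
    and sub: "hj_subsolution E H c T0 T1 u" and super: "hj_supersolution E H' c' T0 T1 v"
    and H_le: "\<And>\<gamma> s p. \<gamma> \<in> E \<Longrightarrow> s \<in> {0..1} \<Longrightarrow> H' \<gamma> (s, p) \<le> H \<gamma> (s, p) + \<kappa>"
    and c_le: "\<And>x. x \<in> vertices E \<Longrightarrow> c x \<le> c' x + \<kappa>"
    and init: "\<And>x. x \<in> support E \<Longrightarrow> u (x, T0) - v (x, T0) \<le> m"
    and x: "x \<in> support E" and t: "t \<in> time_interval T0 T1"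
  shows "u (x, t) - v (x, t) \<le> m + \<kappa> * (t - T0)"
proof (rule ccontr)
  assume contra: "\<not> ?thesis"
  interpret network E by fact
  interpret hamiltonians E H by fact
  have "T0 \<noteq> t"
    using contra init[OF x] by auto
  then have "T0 < t" "ereal t < T1"
    using t by (auto simp: time_interval_def)
  \<comment> \<open>Continuity is given only before \<open>T1\<close>; an intermediate
    \<open>T\<close> provides compactness.\<close>
  then obtain T where T: "t < T" "ereal T < T1"
    using ereal_dense2 by (metis less_ereal.simps(1))
  have I: "{T0..T} \<subseteq> time_interval T0 T1"
    using T le_less_trans[of "ereal _" "ereal T" T1] by (auto simp: time_interval_def)
  have contu: "continuous_on (support E \<times> {T0..T}) u" and contv: "continuous_on (support E \<times> {T0..T}) v"
    using sub super I unfolding hj_subsolution_def hj_supersolution_def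
    by (meson Sigma_mono continuous_on_subset order_refl)+
  have "compact (support E \<times> {T0..T})" "(x, t) \<in> support E \<times> {T0..T}"
    using x T \<open>T0 < t\<close> by (auto intro!: compact_Times compact_support)
  then obtain C where C: "\<And>z. z \<in> support E \<times> {T0..T} \<Longrightarrow> u z - v z \<le> C"
    using continuous_attains_sup[OF _ _ continuous_on_diff[OF contu contv]] by blast
  define \<delta> where "\<delta> = u (x, t) - v (x, t) - (m + \<kappa> * (t - T0))"
  have "0 < \<delta>"
    using contra by (simp add: \<delta>_def)
  \<comment> \<open>\<open>g t < \<delta>\<close> keeps the value at \<open>(x, t)\<close> positive;
    positivity of \<open>g\<close> makes it negative at \<open>T0\<close>, and the size of
    \<open>g T\<close> does so at \<open>T\<close>. Monotonicity of \<open>g'\<close> gives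
    \<open>P'\<close> the uniform gap \<open>g' T0\<close> over \<open>\<kappa>\<close>.\<close>
  obtain g g' where g: "\<And>t. (g has_real_derivative g' t) (at t)" "continuous_on UNIV g'"
    "\<And>t. 0 < g t" "mono g'" "\<And>t. 0 < g' t" "g t < \<delta>" "C - (m + \<kappa> * (T - T0)) < g T"
    using exponential_barrier[OF T(1) \<open>0 < \<delta>\<close>] by metis
  define P where "P t = m + \<kappa> * (t - T0) + g t" for t
  define P' where "P' t = \<kappa> + g' t" for t
  have P: "(P has_real_derivative P' t) (at t)" for t
    unfolding P_def P'_def by (auto intro!: derivative_eq_intros g(1))
  have P'cont: "continuous_on UNIV P'"
    unfolding P'_def by (intro continuous_intros g(2))
  have contP: "continuous_on UNIV P"
    using P by (meson DERIV_isCont continuous_at_imp_continuous_on)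
  have P'_ge: "\<kappa> + g' T0 \<le> P' t" if "t \<in> {T0..T}" for t
    using that monoD[OF g(4), of T0 t] by (simp add: P'_def)
  define M where "M = u (x, t) - v (x, t) - P t"
  have M: "0 < M"
    using g(6) by (simp add: M_def P_def \<delta>_def)
  define B where "B = support E \<times> ({T0..T} \<times> {T0..T})"
  define F where "F z = u (fst z, fst (snd z)) - v (fst z, snd (snd z)) - P (fst (snd z))" for z
  define d :: "'a \<times> real \<times> real \<Rightarrow> real" where "d z = (fst (snd z) - snd (snd z))^2" for z
  have B: "compact B"
    unfolding B_def by (intro compact_Times compact_support) auto
  have contF: "continuous_on B F"
    unfolding F_def
    by (intro continuous_intros continuous_on_compose2[OF contu] continuous_on_compose2[OF contv]
        continuous_on_compose2[OF contP]) (auto simp: B_def)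
  have contd: "continuous_on B d"
    unfolding d_def by (intro continuous_intros)
  \<comment> \<open>Only the faces in time count as boundary here; vertices are excluded later
    through the equation.\<close>
  define Bd where "Bd = B - UNIV \<times> ({T0<..<T} \<times> {T0<..<T})"
  have Bd: "compact Bd" "Bd \<subseteq> B"
    unfolding Bd_def by (auto intro!: compact_diff B open_Times)
  have less: "F z < M" if "z \<in> Bd" "d z = 0" for z
  proof -
    obtain y \<tau> \<tau>' where z: "z = (y, \<tau>, \<tau>')" by (metis surj_pair)
    have eq: "\<tau>' = \<tau>" and y: "y \<in> support E" and "\<tau> = T0 \<or> \<tau> = T"
      using that z by (auto simp: d_def Bd_def B_def)
    from this(3) show ?thesis
    proof
      assume "\<tau> = T0"
      then show ?thesis
        using init[OF y] g(3)[of T0] M by (simp add: z eq F_def P_def)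
    next
      assume "\<tau> = T"
      then show ?thesis
        using C[of "(y, T)"] g(7) M y T \<open>T0 < t\<close> by (simp add: z eq F_def P_def)
    qed
  qed
  have "0 \<le> d z" for z
    by (simp add: d_def)
  then obtain K where K: "0 \<le> K" "\<And>z. z \<in> Bd \<Longrightarrow> F z - K * d z < M"
    using penalization[OF Bd(1) continuous_on_subset[OF contF Bd(2)] continuous_on_subset[OF contd Bd(2)] _ less]
    by blast
  have xB: "(x, t, t) \<in> B"
    using x T \<open>T0 < t\<close> by (simp add: B_def)
  have "continuous_on B (\<lambda>z. F z - K * d z)"
    by (intro continuous_intros contF contd)
  then obtain z where z: "z \<in> B" "\<And>z'. z' \<in> B \<Longrightarrow> F z' - K * d z' \<le> F z - K * d z"
    using continuous_attains_sup[OF B] xB by blast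
  obtain x0 t0 t0' where zeq: "z = (x0, t0, t0')" by (metis surj_pair)
  define M' where "M' = F z - K * d z"
  have \<Psi>: "F (y, \<tau>, \<tau>') - K * d (y, \<tau>, \<tau>') = u (y, \<tau>) - v (y, \<tau>') - P \<tau> - K * (\<tau> - \<tau>')^2" for y \<tau> \<tau>'
    by (simp add: F_def d_def)
  have M': "M \<le> M'"
    using z(2)[OF xB] by (simp add: M'_def \<Psi> M_def)
  have interior: "\<tau> \<in> {T0<..<T} \<and> \<tau>' \<in> {T0<..<T}"
    if "(y, \<tau>, \<tau>') \<in> B" "M' \<le> F (y, \<tau>, \<tau>') - K * d (y, \<tau>, \<tau>')" for y \<tau> \<tau>'
    using K(2)[of "(y, \<tau>, \<tau>')"] that M' by (force simp: Bd_def)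
  \<comment> \<open>All maximizers over vertices are excluded, not only \<open>z\<close>, because
    \<open>arc_maximum_on_boundary\<close> asks for strict inequality at both ends of the
    arc.\<close>
  have novertex: "F (y, \<tau>, \<tau>') - K * d (y, \<tau>, \<tau>') < M'" if "(y, \<tau>, \<tau>') \<in> B" "y \<in> vertices E" for y \<tau> \<tau>'
  proof (rule ccontr)
    assume "\<not> ?thesis"
    then have ge: "M' \<le> F (y, \<tau>, \<tau>') - K * d (y, \<tau>, \<tau>')" by simp
    note int = interior[OF that(1) ge]
    show False
    proof (rule vertex_not_maximum[OF net ham flux sub super T(2) H_le c_le P P'cont that(2)])
      show "\<tau> \<in> {T0<..<T}" "\<tau>' \<in> {T0<..<T}"
        using int by auto
      show "\<kappa> < P' \<tau>"
        using g(5)[of \<tau>] by (simp add: P'_def)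
      show "u (y', r) - v (y', r') - P r - K * (r - r')^2 \<le> u (y, \<tau>) - v (y, \<tau>') - P \<tau> - K * (\<tau> - \<tau>')^2"
        if "y' \<in> support E" "r \<in> {T0..T}" "r' \<in> {T0..T}" for y' r r'
        using z(2)[of "(y', r, r')"] ge that unfolding M'_def[symmetric] \<Psi> by (simp add: B_def)
    qed
  qed
  have "x0 \<in> support E"
    using z(1) zeq by (simp add: B_def)
  then obtain \<gamma> s0 where \<gamma>: "\<gamma> \<in> E" and s0: "s0 \<in> {0..1}" "x0 = \<gamma> s0"
    by (auto simp: support_def path_image_def)
  note in_support = arc_in_support[OF \<gamma>]
  show False
  proof (rule arc_maximum_on_boundary[of "H \<gamma>" T0 T1 "along u \<gamma>" "H' \<gamma>" "along v \<gamma>" T])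
    show "arc_subsolution (H \<gamma>) T0 T1 (along u \<gamma>)" "arc_supersolution (H' \<gamma>) T0 T1 (along v \<gamma>)"
      using sub super \<gamma> by (auto simp: hj_subsolution_def hj_supersolution_def)
    show "continuous_on ({0..1} \<times> {T0..T}) (along u \<gamma>)" "continuous_on ({0..1} \<times> {T0..T}) (along v \<gamma>)"
      using contu contv \<gamma> by (auto intro: continuous_along)
    show "t0 \<in> {T0..T}" "t0' \<in> {T0..T}"
      using z(1) zeq by (auto simp: B_def)
    show "\<kappa> + g' T0 \<le> P' \<tau>" if "\<tau> \<in> {T0..T}" for \<tau>
      using that by (rule P'_ge)
    show "M' \<le> along u \<gamma> (s0, t0) - along v \<gamma> (s0, t0') - P t0 - K * (t0 - t0')^2"
      using s0(2) by (simp add: M'_def zeq \<Psi> along_def)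
    show "along u \<gamma> (s, \<tau>) - along v \<gamma> (s, \<tau>') - P \<tau> - K * (\<tau> - \<tau>')^2 < M'"
      if "s \<in> {0..1}" "\<tau> \<in> {T0..T}" "\<tau>' \<in> {T0..T}"
        "s \<notin> {0<..<1} \<or> \<tau> \<notin> {T0<..<T} \<or> \<tau>' \<notin> {T0<..<T}" for s \<tau> \<tau>'
    proof -
      have inB: "(\<gamma> s, \<tau>, \<tau>') \<in> B"
        using that in_support by (simp add: B_def)
      have "F (\<gamma> s, \<tau>, \<tau>') - K * d (\<gamma> s, \<tau>, \<tau>') < M'"
      proof (cases "s \<in> {0<..<1}")
        case False
        then have "s = 0 \<or> s = 1"
          using that(1) by auto
        then show ?thesis
          using novertex[OF inB] endpoints_in_vertices[OF \<gamma>] by auto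
      next
        case True
        then show ?thesis
          using interior[OF inB] that(4) by (meson not_le)
      qed
      then show ?thesis
        by (simp add: \<Psi> along_def)
    qed
  qed (use T \<open>T0 < t\<close> \<gamma> H_le P P'cont g(5) K(1) s0 continuous coercive in auto)
qed

section \<open>Stability\<close>

text \<open>Makes the limit problem admissible on the subsolution side of
  \<open>continuous_dependence\<close>. In the form of \<open>le_arc_constant_iff\<close>, the error
  \<open>e\<close> is shared between the Hamiltonians, the limiters and the choice of
  \<open>p\<close>.\<close>

lemma flux_limiter_limit:
  fixes E :: "(real \<Rightarrow> 'a::euclidean_space) set"
  assumes "network E" and ham: "hamiltonians E H" and hamn: "\<And>n. hamiltonians E (Hn n)"
    and flux: "\<And>n. flux_limiter E (Hn n) (cn n)"
    and H_lim: "\<And>\<gamma>. \<gamma> \<in> E \<Longrightarrow> uniform_limit ({0..1} \<times> UNIV) (\<lambda>n. Hn n \<gamma>) (H \<gamma>) sequentially"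
    and c_lim: "\<And>x. x \<in> vertices E \<Longrightarrow> (\<lambda>n. cn n x) \<longlonglongrightarrow> c x"
  shows "flux_limiter E H c"
proof -
  interpret network E by fact
  interpret hamiltonians E H by fact
  show ?thesis
    unfolding flux_limiter_iff
  proof (intro ballI)
    fix x \<gamma> assume x: "x \<in> vertices E" and \<gamma>: "\<gamma> \<in> arcs_into E x"
    then have \<gamma>E: "\<gamma> \<in> E" by (simp add: arcs_into_def)
    show "c x \<le> arc_constant H \<gamma>"
      unfolding le_arc_constant_iff[OF \<gamma>E]
    proof (intro ballI allI impI)
      fix s e :: real assume s: "s \<in> {0..1}" and "0 < e"
      then have "0 < e / 3" by simp
      have "\<forall>\<^sub>F n in sequentially. (\<forall>z\<in>{0..1} \<times> UNIV. dist (Hn n \<gamma> z) (H \<gamma> z) < e / 3) \<and>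
          dist (cn n x) (c x) < e / 3"
        by (intro eventually_conj uniform_limitD[OF H_lim[OF \<gamma>E]] tendstoD[OF c_lim[OF x]] \<open>0 < e / 3\<close>)
      then obtain n where n: "\<And>p. dist (Hn n \<gamma> (s, p)) (H \<gamma> (s, p)) < e / 3" "dist (cn n x) (c x) < e / 3"
        using eventually_happens'[OF sequentially_bot] s by blast
      have "cn n x \<le> arc_constant (Hn n) \<gamma>"
        using flux[of n] x \<gamma> by (auto simp: flux_limiter_iff)
      then obtain p where "Hn n \<gamma> (s, p) < - cn n x + e / 3"
        using hamiltonians.le_arc_constant_iff[OF hamn \<gamma>E] s \<open>0 < e / 3\<close> by blast
      then show "\<exists>p. H \<gamma> (s, p) < - c x + e"
        using n(1)[of p] n(2) unfolding dist_real_def by (intro exI[of _ p]) linarith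
    qed
  qed
qed

theorem theorem7p9:
  fixes E :: "(real \<Rightarrow> real ^ 'N) set"
    and H :: "(real \<Rightarrow> real ^ 'N) \<Rightarrow> real \<times> real \<Rightarrow> real"
    and Hn :: "nat \<Rightarrow> (real \<Rightarrow> real ^ 'N) \<Rightarrow> real \<times> real \<Rightarrow> real"
    and c :: "real ^ 'N \<Rightarrow> real" and cn :: "nat \<Rightarrow> real ^ 'N \<Rightarrow> real"
    and g :: "real ^ 'N \<Rightarrow> real" and gn :: "nat \<Rightarrow> real ^ 'N \<Rightarrow> real"
    and un :: "nat \<Rightarrow> (real ^ 'N) \<times> real \<Rightarrow> real"
    and T0 :: real and T1 :: ereal
  assumes "0 \<le> T0" and "ereal T0 < T1"
    and "network E"
    and "hamiltonians E H" and "\<And>n. hamiltonians E (Hn n)"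
    and "\<And>n. flux_limiter E (Hn n) (cn n)"
    and "\<And>n. continuous_on (support E) (gn n)"
    and "\<And>\<gamma>. \<gamma> \<in> E \<Longrightarrow> uniform_limit ({0..1} \<times> UNIV) (\<lambda>n. Hn n \<gamma>) (H \<gamma>) sequentially"
    and "uniform_limit (support E) gn g sequentially"
    and "\<And>x. x \<in> vertices E \<Longrightarrow> (\<lambda>n. cn n x) \<longlonglongrightarrow> c x"
    and "\<And>n. hj_solution E (Hn n) (cn n) T0 T1 (un n)"
    and "\<And>n x. x \<in> support E \<Longrightarrow> un n (x, T0) = gn n x"
  shows "flux_limiter E H c \<and> continuous_on (support E) g \<and>
    (\<forall>u. hj_solution E H c T0 T1 u \<and> (\<forall>x\<in>support E. u (x, T0) = g x) \<longrightarrow>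
       locally_uniform_limit (support E \<times> time_interval T0 T1) un u)"
proof -
  interpret network E by fact
  note lims = \<open>\<And>\<gamma>. \<gamma> \<in> E \<Longrightarrow> uniform_limit ({0..1} \<times> UNIV) (\<lambda>n. Hn n \<gamma>) (H \<gamma>) sequentially\<close>
    \<open>uniform_limit (support E) gn g sequentially\<close>
    \<open>\<And>x. x \<in> vertices E \<Longrightarrow> (\<lambda>n. cn n x) \<longlonglongrightarrow> c x\<close>
  \<comment> \<open>This and the continuity of \<open>g\<close> are what makes the limit problem
    well posed, so that its solution \<open>u\<close> is meaningful.\<close>
  have flux: "flux_limiter E H c"
    by (rule flux_limiter_limit[OF assms(3-6) lims(1,3)])
  have "continuous_on (support E) g"
    by (rule uniform_limit_theorem[OF _ lims(2)]) (simp_all add: assms(7))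
  moreover have "locally_uniform_limit (support E \<times> time_interval T0 T1) un u"
    if sol: "hj_solution E H c T0 T1 u" and init: "\<forall>x\<in>support E. u (x, T0) = g x" for u
    unfolding locally_uniform_limit_def
  proof (intro allI impI uniform_limitI, elim conjE)
    fix K and e :: real
    assume K: "compact K" "K \<subseteq> support E \<times> time_interval T0 T1" and "0 < e"
    have "bounded (snd ` K)"
      using K(1) by (intro compact_imp_bounded compact_continuous_image continuous_intros)
    then obtain b where b0: "\<And>z. z \<in> K \<Longrightarrow> \<bar>snd z\<bar> \<le> b"
      by (auto simp: bounded_iff)
    then have b: "snd z - T0 \<le> max 1 (b - T0)" if "z \<in> K" for z
      using abs_le_D1[OF b0[OF that]] by linarith
    \<comment> \<open>Chosen so that \<open>\<kappa> * (t - T0) \<le> e / 3\<close> on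
      \<open>K\<close>; the maximum with 1 keeps the divisor positive.\<close>
    define \<kappa> where "\<kappa> = e / (3 * max 1 (b - T0))"
    have "0 < \<kappa>" and \<kappa>: "\<kappa> * max 1 (b - T0) = e / 3"
      using \<open>0 < e\<close> by (auto simp: \<kappa>_def less_max_iff_disj)
    \<comment> \<open>Finiteness of the arcs and of the vertices yields one threshold for all of
      them.\<close>
    have "\<forall>\<^sub>F n in sequentially. \<forall>\<gamma>\<in>E. \<forall>z\<in>{0..1} \<times> UNIV. dist (Hn n \<gamma> z) (H \<gamma> z) < \<kappa>"
      by (intro eventually_ball_finite finite_arcs ballI uniform_limitD[OF lims(1)] \<open>0 < \<kappa>\<close>)
    moreover have "\<forall>\<^sub>F n in sequentially. \<forall>x\<in>vertices E. dist (cn n x) (c x) < \<kappa>"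
      by (intro eventually_ball_finite finite_vertices ballI tendstoD[OF lims(3)] \<open>0 < \<kappa>\<close>)
    moreover have "\<forall>\<^sub>F n in sequentially. \<forall>x\<in>support E. dist (gn n x) (g x) < e / 3"
      using \<open>0 < e\<close> by (intro uniform_limitD[OF lims(2)]) simp
    ultimately show "\<forall>\<^sub>F n in sequentially. \<forall>z\<in>K. dist (un n z) (u z) < e"
    proof eventually_elim
      case (elim n)
      show ?case
      proof
        fix z assume "z \<in> K"
        obtain x t where z: "z = (x, t)" by force
        have x: "x \<in> support E" and t: "t \<in> time_interval T0 T1"
          using \<open>z \<in> K\<close> K(2) z by auto
        have H_le: "\<bar>Hn n \<gamma> (s, p) - H \<gamma> (s, p)\<bar> \<le> \<kappa>" if "\<gamma> \<in> E" "s \<in> {0..1}" for \<gamma> s p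
          using bspec[OF bspec[OF elim(1) that(1)], of "(s, p)"] that(2) by (simp add: dist_real_def)
        have c_le: "\<bar>cn n y - c y\<bar> \<le> \<kappa>" if "y \<in> vertices E" for y
          using bspec[OF elim(2) that] by (simp add: dist_real_def)
        have g_le: "\<bar>un n (y, T0) - u (y, T0)\<bar> \<le> e / 3" if "y \<in> support E" for y
          using bspec[OF elim(3) that] bspec[OF init that] assms(12)[OF that] by (simp add: dist_real_def)
        have "\<kappa> * (t - T0) \<le> e / 3"
          using b[OF \<open>z \<in> K\<close>] \<open>0 < \<kappa>\<close> mult_left_mono[of "t - T0" "max 1 (b - T0)" \<kappa>] by (simp add: z \<kappa>)
        \<comment> \<open>The comparison is applied in both directions, each giving a difference of
          at most \<open>2 * e / 3\<close>.\<close>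
        moreover have "un n (x, t) - u (x, t) \<le> e / 3 + \<kappa> * (t - T0)"
        proof (rule continuous_dependence[OF assms(3) assms(5) assms(6)[of n]])
          show "hj_subsolution E (Hn n) (cn n) T0 T1 (un n)"
            using assms(11) by (simp add: hj_solution_def)
          show "hj_supersolution E H c T0 T1 u"
            using sol by (simp add: hj_solution_def)
          show "H \<gamma> (s, p) \<le> Hn n \<gamma> (s, p) + \<kappa>" if "\<gamma> \<in> E" "s \<in> {0..1}" for \<gamma> s p
            using H_le[OF that, of p] by linarith
          show "cn n y \<le> c y + \<kappa>" if "y \<in> vertices E" for y
            using c_le[OF that] by linarith
          show "un n (y, T0) - u (y, T0) \<le> e / 3" if "y \<in> support E" for y
            using g_le[OF that] by linarith
        qed (fact x t)+
        moreover have "u (x, t) - un n (x, t) \<le> e / 3 + \<kappa> * (t - T0)"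
        proof (rule continuous_dependence[OF assms(3,4) flux])
          show "hj_subsolution E H c T0 T1 u"
            using sol by (simp add: hj_solution_def)
          show "hj_supersolution E (Hn n) (cn n) T0 T1 (un n)"
            using assms(11) by (simp add: hj_solution_def)
          show "Hn n \<gamma> (s, p) \<le> H \<gamma> (s, p) + \<kappa>" if "\<gamma> \<in> E" "s \<in> {0..1}" for \<gamma> s p
            using H_le[OF that, of p] by linarith
          show "c y \<le> cn n y + \<kappa>" if "y \<in> vertices E" for y
            using c_le[OF that] by linarith
          show "u (y, T0) - un n (y, T0) \<le> e / 3" if "y \<in> support E" for y
            using g_le[OF that] by linarith
        qed (fact x t)+
        ultimately show "dist (un n z) (u z) < e"
          using \<open>0 < e\<close> by (simp add: z dist_real_def)
      qed
    qed
  qed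
  ultimately show ?thesis
    using flux by blast
qed

end
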